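(* (i) For every $n\ge 2$, the independence polynomial of the well-covered spider $S_n=K_{1,n}^*$ is $$I(S_n;x)=(1+x)\left\{1+\sum_{k=1}^{n}\left[\binom{n}{k}2^k+\binom{n-1}{k-1}\right]x^k\right\}.$$ (ii) If $G$ is a graph such that $G^*$ is connected, then the multiplicity of $-1$ as a root of $I(G^*;x)$ equals $1$ if and only if $G$ is isomorphic to $K_{1,n}$ for some $n\ge 1$. (iii) If $G$ is a graph such that $G^*$ is connected, $T$ is a well-covered spider, and $I(G^*;x)=I(T;x)$, then $G^*$ is isomorphic to $T$.
   Context: Graphs are finite and simple. A stable set is a set of pairwise non-adjacent vertices; with $s_k$ the number of stable sets of size $k$ ($s_0=1$), the independence polynomial is $I(G;x)=\sum_{k\ge0}s_kx^k$. For a graph $G$ with vertices $v_1,\dots,v_n$, $G^*$ is obtained by adding new vertices $u_1,\dots,u_n$ and edges $u_iv_i$, i.e., attaching one pendant edge to each vertex of $G$. $K_{1,n}$ is the star with $n$ leaves. A graph is well-covered if all its maximal stable sets have the same cardinality. A spider is a tree having at most one vertex of degree at least $3$. *)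

theory Defs
  imports "Graph_Theory.Graph_Theory" "HOL-Computational_Algebra.Polynomial"
begin

text \<open>
  A finite simple graph is a \<^locale>\<open>pair_graph\<close>: finite, loop-free and symmetric, so that every
  edge \<open>uv\<close> is represented by the two arcs \<open>(u, v)\<close> and \<open>(v, u)\<close>.
\<close>

definition stable_set :: "'a pair_pre_digraph \<Rightarrow> 'a set \<Rightarrow> bool" where
  "stable_set G S \<longleftrightarrow> S \<subseteq> pverts G \<and> (\<forall>u\<in>S. \<forall>v\<in>S. (u, v) \<notin> parcs G)"

definition num_stable :: "'a pair_pre_digraph \<Rightarrow> nat \<Rightarrow> nat" where
  "num_stable G k = card {S. stable_set G S \<and> card S = k}"

definition indep_poly :: "'a pair_pre_digraph \<Rightarrow> real poly" where
  "indep_poly G = (\<Sum>k\<le>card (pverts G). monom (of_nat (num_stable G k)) k)"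

definition maximal_stable_set :: "'a pair_pre_digraph \<Rightarrow> 'a set \<Rightarrow> bool" where
  "maximal_stable_set G S \<longleftrightarrow> stable_set G S \<and> (\<forall>S'. stable_set G S' \<and> S \<subseteq> S' \<longrightarrow> S' = S)"

definition well_covered :: "'a pair_pre_digraph \<Rightarrow> bool" where
  "well_covered G \<longleftrightarrow>
    (\<forall>S S'. maximal_stable_set G S \<and> maximal_stable_set G S' \<longrightarrow> card S = card S')"

text \<open>
  \<open>G\<^sup>*\<close>: the vertex \<open>v\<close> of \<open>G\<close> becomes \<open>Inl v\<close>, and \<open>Inr v\<close> is the new vertex pendant at it.
\<close>

definition pendant_graph :: "'a pair_pre_digraph \<Rightarrow> ('a + 'a) pair_pre_digraph" where
  "pendant_graph G =
    \<lparr> pverts = Inl ` pverts G \<union> Inr ` pverts G,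
      parcs = {(Inl u, Inl v) | u v. (u, v) \<in> parcs G}
        \<union> {(Inl v, Inr v) | v. v \<in> pverts G} \<union> {(Inr v, Inl v) | v. v \<in> pverts G} \<rparr>"

definition star :: "nat \<Rightarrow> nat pair_pre_digraph" where
  "star n = \<lparr> pverts = {0..n}, parcs = {0} \<times> {1..n} \<union> {1..n} \<times> {0} \<rparr>"

definition graph_iso :: "'a pair_pre_digraph \<Rightarrow> 'b pair_pre_digraph \<Rightarrow> bool" where
  "graph_iso G H \<longleftrightarrow> digraph_iso (with_proj G) (with_proj H)"

definition graph_connected :: "'a pair_pre_digraph \<Rightarrow> bool" where
  "graph_connected G \<longleftrightarrow> Digraph_Component.connected (with_proj G)"

text \<open>
  The library predicate \<^const>\<open>Digraph_Component.tree\<close> counts the closed walk \<open>(u, v), (v, u)\<close> along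
  a single edge as a cycle. A cycle of a simple graph has at least three edges.
\<close>

definition graph_tree :: "'a pair_pre_digraph \<Rightarrow> bool" where
  "graph_tree G \<longleftrightarrow> pair_graph G \<and> graph_connected G
    \<and> \<not> (\<exists>p. pre_digraph.cycle (with_proj G) p \<and> length p \<ge> 3)"

text \<open>In a symmetric graph the out-degree is the degree.\<close>

definition spider :: "'a pair_pre_digraph \<Rightarrow> bool" where
  "spider G \<longleftrightarrow> graph_tree G \<and> card {v \<in> pverts G. out_degree (with_proj G) v \<ge> 3} \<le> 1"

lemma pair_graph_pendant_graph:
  assumes "pair_graph G"
  shows "pair_graph (pendant_graph G)"
proof -
  interpret pair_graph G by fact
  have sym: "(v, u) \<in> parcs G" if "(u, v) \<in> parcs G" for u v
    using pair_sym_arcs that by (auto simp: symmetric_def sym_def)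
  have eq: "{(Inl u, Inl v) | u v. (u, v) \<in> parcs G} = map_prod Inl Inl ` parcs G"
    "{(Inl v, Inr v) | v. v \<in> pverts G} = (\<lambda>v. (Inl v, Inr v)) ` pverts G"
    "{(Inr v, Inl v) | v. v \<in> pverts G} = (\<lambda>v. (Inr v, Inl v)) ` pverts G"
    by (auto simp: map_prod_def image_iff split: prod.splits)
  have fin: "finite (parcs (pendant_graph G))"
    unfolding pendant_graph_def pair_pre_digraph.simps eq
    using pair_finite_verts pair_finite_arcs by simp
  have wf: "fst e \<in> pverts (pendant_graph G)" "snd e \<in> pverts (pendant_graph G)" "fst e \<noteq> snd e"
    if "e \<in> parcs (pendant_graph G)" for e
    using that pair_no_loops[of "(u, u)" for u]
    by (auto simp: pendant_graph_def dest: in_arcsD1 in_arcsD2)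
  have "symmetric (with_proj (pendant_graph G))"
    by (auto simp: pendant_graph_def symmetric_def sym_def dest: sym)
  moreover have "finite (pverts (pendant_graph G))"
    using pair_finite_verts by (simp add: pendant_graph_def)
  ultimately show ?thesis
    using fin wf by unfold_locales
qed

lemma pair_graph_star: "pair_graph (star n)"
  by unfold_locales (auto simp: star_def symmetric_def intro!: symI)

lemma star_complete_bipartite: "complete_bipartite_digraph 1 n (with_proj (star n))"
proof -
  interpret pair_graph "star n" by (rule pair_graph_star)
  have "graph (with_proj (star n))" by unfold_locales
  moreover have "{0..n} = {0} \<union> {1..n}" by auto
  ultimately show ?thesis
    unfolding complete_bipartite_digraph_def
    by (intro conjI exI[of _ "{0}"] exI[of _ "{1..n}"]) (auto simp: star_def)
qed

end

theory Submission
  imports Defs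
begin

text \<open>
  A stable set of \<open>G\<^sup>*\<close> is a stable set \<open>S\<close> of \<open>G\<close> together with pendant vertices attached outside \<open>S\<close>,
  so \<open>I(G\<^sup>*; x)\<close> is the sum of \<open>x^|S| (1 + x)^(n - |S|)\<close> over the stable sets \<open>S\<close> of \<open>G\<close>, where
  \<open>n\<close> is the order of \<open>G\<close>. Hence \<open>-1\<close> is a root of multiplicity \<open>n - \<alpha>(G)\<close>, and \<open>\<alpha>(G) = n - 1\<close>
  characterises the stars among the connected graphs with an edge.

  For the last part, every well-covered spider other than \<open>K\<^sub>1\<close> is \<open>K\<^sub>1\<^sub>,\<^sub>m\<^sup>*\<close> for some \<open>m\<close>: by
  exchanging parts of a maximal stable set, all legs have length at most two and exactly one leg has
  length one. The coefficient of \<open>x\<close> determines the number of vertices and excludes \<open>K\<^sub>1\<close>, and the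
  multiplicity of \<open>-1\<close> forces \<open>G\<close> to be a star.
\<close>

section \<open>Isomorphisms of simple graphs\<close>

text \<open>The library notion also carries an arc map together with new tail and head functions.
  Arcs here are pairs with the projections as ends, so the arc map is forced to act as the vertex
  map on both ends.\<close>

lemma graph_iso_iff_bij_betw:
  assumes "pair_graph G" "pair_graph H"
  shows "graph_iso G H \<longleftrightarrow> (\<exists>f. bij_betw f (pverts G) (pverts H) \<and>
    (\<forall>u\<in>pverts G. \<forall>v\<in>pverts G. (u, v) \<in> parcs G \<longleftrightarrow> (f u, f v) \<in> parcs H))"
    (is "_ \<longleftrightarrow> (\<exists>f. ?iso f)")
proof -
  interpret G: pair_graph G by fact
  interpret H: pair_graph H by fact
  show ?thesis
  proof
    assume "graph_iso G H"
    then obtain h where h: "G.digraph_isomorphism h" and H: "with_proj H = app_iso h (with_proj G)"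
      by (auto simp: graph_iso_def digraph_iso_def)
    from H have verts: "pverts H = iso_verts h ` pverts G" and arcs: "parcs H = iso_arcs h ` parcs G"
      and tail: "iso_tail h = fst" and head: "iso_head h = snd"
      by (simp_all add: with_proj_def app_iso_def)
    have inj: "inj_on (iso_verts h) (pverts G)"
      using h by (simp add: G.digraph_isomorphism_def)
    have arc: "iso_arcs h a = (iso_verts h (fst a), iso_verts h (snd a))" if "a \<in> parcs G" for a
      using h that by (auto simp: G.digraph_isomorphism_def tail head prod_eq_iff)
    have "(u, v) \<in> parcs G \<longleftrightarrow> (iso_verts h u, iso_verts h v) \<in> parcs H"
      if "u \<in> pverts G" "v \<in> pverts G" for u v
    proof
      assume "(u, v) \<in> parcs G"
      then show "(iso_verts h u, iso_verts h v) \<in> parcs H"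
        using arc arcs by force
    next
      assume "(iso_verts h u, iso_verts h v) \<in> parcs H"
      then obtain x y where "(x, y) \<in> parcs G" "iso_verts h u = iso_verts h x" "iso_verts h v = iso_verts h y"
        using arc arcs by force
      then show "(u, v) \<in> parcs G"
        using that inj G.in_arcsD1 G.in_arcsD2 by (metis inj_onD)
    qed
    then show "\<exists>f. ?iso f"
      using inj verts by (intro exI[of _ "iso_verts h"]) (auto simp: bij_betw_def)
  next
    assume "\<exists>f. ?iso f"
    then obtain f where bij: "bij_betw f (pverts G) (pverts H)"
      and adj: "\<And>u v. u \<in> pverts G \<Longrightarrow> v \<in> pverts G \<Longrightarrow> (u, v) \<in> parcs G \<longleftrightarrow> (f u, f v) \<in> parcs H"
      by auto
    have arcs: "parcs H = map_prod f f ` parcs G"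
    proof (intro equalityI subsetI)
      fix e assume e: "e \<in> parcs H"
      then have "fst e \<in> f ` pverts G" "snd e \<in> f ` pverts G"
        using bij H.arc_fst_in_verts H.arc_snd_in_verts by (auto simp: bij_betw_def)
      then obtain x y where "x \<in> pverts G" "y \<in> pverts G" "e = (f x, f y)"
        by (auto simp: prod_eq_iff)
      then show "e \<in> map_prod f f ` parcs G"
        using e adj by force
    next
      fix e assume "e \<in> map_prod f f ` parcs G"
      then obtain x y where "(x, y) \<in> parcs G" "e = (f x, f y)"
        by auto
      then show "e \<in> parcs H"
        using adj[OF G.in_arcsD1 G.in_arcsD2] by blast
    qed
    have inj: "inj_on (map_prod f f) (parcs G)"
      using bij map_prod_inj_on[of f "pverts G" f "pverts G"]
      by (rule_tac inj_on_subset[of _ "pverts G \<times> pverts G"])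
        (auto simp: bij_betw_def dest: G.in_arcsD1 G.in_arcsD2)
    have "wf_digraph (with_proj G)"
      by unfold_locales
    then have "G.digraph_isomorphism \<lparr>iso_verts = f, iso_arcs = map_prod f f, iso_head = snd, iso_tail = fst\<rparr>"
      using bij inj by (auto simp: G.digraph_isomorphism_def bij_betw_def)
    moreover have "with_proj H = app_iso \<lparr>iso_verts = f, iso_arcs = map_prod f f, iso_head = snd, iso_tail = fst\<rparr> (with_proj G)"
      using bij arcs by (simp add: with_proj_def app_iso_def bij_betw_def)
    ultimately show "graph_iso G H"
      by (auto simp: graph_iso_def digraph_iso_def)
  qed
qed

lemma graph_iso_sym:
  assumes "pair_graph G" "pair_graph H" "graph_iso G H"
  shows "graph_iso H G"
proof -
  obtain f where bij: "bij_betw f (pverts G) (pverts H)"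
    and adj: "\<And>u v. u \<in> pverts G \<Longrightarrow> v \<in> pverts G \<Longrightarrow> (u, v) \<in> parcs G \<longleftrightarrow> (f u, f v) \<in> parcs H"
    using assms by (auto simp: graph_iso_iff_bij_betw)
  let ?g = "inv_into (pverts G) f"
  have "?g x \<in> pverts G" "f (?g x) = x" if "x \<in> pverts H" for x
    using that bij by (auto simp: bij_betw_def inv_into_into f_inv_into_f)
  then have "\<forall>u\<in>pverts H. \<forall>v\<in>pverts H. (u, v) \<in> parcs H \<longleftrightarrow> (?g u, ?g v) \<in> parcs G"
    using adj by simp
  then show ?thesis
    using assms bij_betw_inv_into[OF bij] by (auto simp: graph_iso_iff_bij_betw)
qed

lemma graph_iso_trans:
  assumes "pair_graph G" "pair_graph H" "pair_graph K" "graph_iso G H" "graph_iso H K"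
  shows "graph_iso G K"
proof -
  obtain f where f: "bij_betw f (pverts G) (pverts H)"
    "\<forall>u\<in>pverts G. \<forall>v\<in>pverts G. (u, v) \<in> parcs G \<longleftrightarrow> (f u, f v) \<in> parcs H"
    using assms by (auto simp: graph_iso_iff_bij_betw)
  obtain g where g: "bij_betw g (pverts H) (pverts K)"
    "\<forall>u\<in>pverts H. \<forall>v\<in>pverts H. (u, v) \<in> parcs H \<longleftrightarrow> (g u, g v) \<in> parcs K"
    using assms by (auto simp: graph_iso_iff_bij_betw)
  have "\<forall>u\<in>pverts G. \<forall>v\<in>pverts G. (u, v) \<in> parcs G \<longleftrightarrow> ((g \<circ> f) u, (g \<circ> f) v) \<in> parcs K"
    using f g by (auto simp: bij_betwE)
  then show ?thesis
    using assms bij_betw_trans[OF f(1) g(1)] unfolding graph_iso_iff_bij_betw[OF assms(1,3)] by blast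
qed

lemma graph_iso_card_verts:
  assumes "pair_graph G" "pair_graph H" "graph_iso G H"
  shows "card (pverts G) = card (pverts H)"
  using assms by (auto simp: graph_iso_iff_bij_betw bij_betw_same_card)

section \<open>Vertices, arcs and isomorphisms of pendant graphs\<close>

lemma pverts_pendant_graph [simp]: "pverts (pendant_graph G) = Inl ` pverts G \<union> Inr ` pverts G"
  by (simp add: pendant_graph_def)

lemma parcs_pendant_graph [simp]:
  "(Inl u, Inl v) \<in> parcs (pendant_graph G) \<longleftrightarrow> (u, v) \<in> parcs G"
  "(Inl u, Inr v) \<in> parcs (pendant_graph G) \<longleftrightarrow> u = v \<and> u \<in> pverts G"
  "(Inr u, Inl v) \<in> parcs (pendant_graph G) \<longleftrightarrow> u = v \<and> u \<in> pverts G"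
  "(Inr u, Inr v) \<notin> parcs (pendant_graph G)"
  by (auto simp: pendant_graph_def)

lemma card_verts_pendant_graph:
  fixes G :: "'a pair_pre_digraph"
  assumes "finite (pverts G)"
  shows "card (pverts (pendant_graph G)) = 2 * card (pverts G)"
proof -
  have "card (pverts (pendant_graph G)) =
      card (Inl ` pverts G :: ('a + 'a) set) + card (Inr ` pverts G :: ('a + 'a) set)"
    unfolding pverts_pendant_graph using assms by (intro card_Un_disjoint) auto
  then show ?thesis by (simp add: card_image)
qed

lemma graph_iso_pendant_graph:
  assumes "pair_graph G" "pair_graph H" "graph_iso G H"
  shows "graph_iso (pendant_graph G) (pendant_graph H)"
proof -
  obtain f where f: "bij_betw f (pverts G) (pverts H)"
    "\<forall>u\<in>pverts G. \<forall>v\<in>pverts G. (u, v) \<in> parcs G \<longleftrightarrow> (f u, f v) \<in> parcs H"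
    using assms by (auto simp: graph_iso_iff_bij_betw)
  have inj: "f u = f v \<longleftrightarrow> u = v" if "u \<in> pverts G" "v \<in> pverts G" for u v
    using f(1) that by (auto simp: bij_betw_def dest: inj_onD)
  have "map_sum f f ` pverts (pendant_graph G) = Inl ` f ` pverts G \<union> Inr ` f ` pverts G"
    unfolding pverts_pendant_graph image_Un image_image by simp
  moreover have "f ` pverts G = pverts H"
    using f(1) by (simp add: bij_betw_def)
  moreover have "inj_on (map_sum f f) (pverts (pendant_graph G))"
    by (auto simp: inj inj_on_def)
  ultimately have "bij_betw (map_sum f f) (pverts (pendant_graph G)) (pverts (pendant_graph H))"
    unfolding bij_betw_def pverts_pendant_graph by presburger
  moreover have "\<forall>u\<in>pverts (pendant_graph G). \<forall>v\<in>pverts (pendant_graph G).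
      (u, v) \<in> parcs (pendant_graph G) \<longleftrightarrow> (map_sum f f u, map_sum f f v) \<in> parcs (pendant_graph H)"
    using f(2) bij_betwE[OF f(1)] by (auto simp: inj)
  ultimately show ?thesis
    unfolding graph_iso_iff_bij_betw[OF assms(1,2)[THEN pair_graph_pendant_graph]] by blast
qed

section \<open>Independence polynomials of pendant graphs\<close>

lemma finite_stable_sets:
  assumes "finite (pverts G)"
  shows "finite {S. stable_set G S}"
  using assms by (rule_tac finite_subset[of _ "Pow (pverts G)"]) (auto simp: stable_set_def)

lemma stable_set_finite:
  assumes "finite (pverts G)" "stable_set G S"
  shows "finite S"
  using assms by (auto simp: stable_set_def intro: finite_subset)

lemma card_stable_set_le:
  assumes "finite (pverts G)" "stable_set G S"
  shows "card S \<le> card (pverts G)"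
  using assms by (auto simp: stable_set_def intro: card_mono)

lemma stable_set_empty [simp]: "stable_set G {}"
  by (simp add: stable_set_def)

text \<open>Grouping the stable sets by size recovers the coefficients. In this form the polynomial
  can be transported along bijections between families of stable sets.\<close>

lemma indep_poly_eq_sum_stable_sets:
  assumes "finite (pverts G)"
  shows "indep_poly G = (\<Sum>S | stable_set G S. monom 1 (card S))"
proof -
  let ?F = "{S. stable_set G S}"
  have "(\<Sum>S\<in>?F. monom (1::real) (card S)) =
      (\<Sum>k\<le>card (pverts G). \<Sum>S | S \<in> ?F \<and> card S = k. monom 1 (card S))"
    using assms card_stable_set_le[OF assms]
    by (intro sum.group[symmetric] finite_stable_sets) auto
  also have "\<dots> = (\<Sum>k\<le>card (pverts G). monom (of_nat (num_stable G k)) k)"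
    by (intro sum.cong refl) (simp add: num_stable_def of_nat_monom mult_monom)
  finally show ?thesis by (simp add: indep_poly_def)
qed

lemma stable_set_image_iff:
  assumes "inj_on f (pverts G)" "f ` pverts G = pverts H"
    and "\<And>u v. u \<in> pverts G \<Longrightarrow> v \<in> pverts G \<Longrightarrow> (u, v) \<in> parcs G \<longleftrightarrow> (f u, f v) \<in> parcs H"
    and "S \<subseteq> pverts G"
  shows "stable_set H (f ` S) \<longleftrightarrow> stable_set G S"
proof -
  have "f ` S \<subseteq> pverts H"
    using assms(2,4) by blast
  moreover have "(u, v) \<in> parcs G \<longleftrightarrow> (f u, f v) \<in> parcs H" if "u \<in> S" "v \<in> S" for u v
    using that assms(3,4) by blast
  ultimately show ?thesis
    using assms(4) by (simp add: stable_set_def)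
qed

text \<open>Taking images under the vertex bijection is a size-preserving bijection between the two
  families of stable sets.\<close>

lemma indep_poly_cong_graph_iso:
  assumes "pair_graph G" "pair_graph H" "graph_iso G H"
  shows "indep_poly G = indep_poly H"
proof -
  interpret G: pair_graph G by fact
  interpret H: pair_graph H by fact
  obtain f where f: "inj_on f (pverts G)" "f ` pverts G = pverts H"
    "\<And>u v. u \<in> pverts G \<Longrightarrow> v \<in> pverts G \<Longrightarrow> (u, v) \<in> parcs G \<longleftrightarrow> (f u, f v) \<in> parcs H"
    using assms by (auto simp: graph_iso_iff_bij_betw bij_betw_def)
  note iff = stable_set_image_iff[OF f]
  have sub: "S \<subseteq> pverts G" if "stable_set G S" for S
    using that by (simp add: stable_set_def)
  have "bij_betw ((`) f) {S. stable_set G S} {S. stable_set H S}"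
  proof (rule bij_betw_imageI)
    show "inj_on ((`) f) {S. stable_set G S}"
      using inj_on_image_Pow[OF f(1)] by (rule inj_on_subset) (auto dest: sub)
    show "(`) f ` {S. stable_set G S} = {S. stable_set H S}"
    proof (intro equalityI subsetI)
      fix R assume R: "R \<in> {S. stable_set H S}"
      then have "R \<subseteq> f ` pverts G"
        using f(2) by (simp add: stable_set_def)
      then obtain S where "S \<subseteq> pverts G" "R = f ` S"
        by (meson subset_imageE)
      with R iff show "R \<in> (`) f ` {S. stable_set G S}"
        by blast
    qed (use iff sub in blast)
  qed
  then have "(\<Sum>S | stable_set H S. monom (1::real) (card S)) = (\<Sum>S | stable_set G S. monom 1 (card (f ` S)))"
    by (rule sum.reindex_bij_betw[symmetric])
  also have "\<dots> = (\<Sum>S | stable_set G S. monom 1 (card S))"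
    using f(1) by (intro sum.cong refl) (metis card_image inj_on_subset mem_Collect_eq sub)
  finally show ?thesis
    by (simp add: indep_poly_eq_sum_stable_sets G.pair_finite_verts H.pair_finite_verts)
qed

text \<open>Without loops every singleton of a vertex is stable. This lets the number of vertices be
  read off from the polynomial.\<close>

lemma coeff_indep_poly_1:
  assumes "pair_graph G"
  shows "coeff (indep_poly G) 1 = card (pverts G)"
proof -
  interpret pair_graph G by fact
  have "{S. stable_set G S \<and> card S = 1} = (\<lambda>v. {v}) ` pverts G"
    using pair_no_loops by (fastforce simp: stable_set_def card_1_singleton_iff)
  then have "num_stable G 1 = card (pverts G)"
    by (simp add: num_stable_def card_image)
  moreover have "coeff (indep_poly G) 1 = (if 1 \<le> card (pverts G) then num_stable G 1 else 0)"
    by (simp add: indep_poly_def coeff_sum)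
  ultimately show ?thesis
    by (auto simp: Suc_le_eq card_gt_0_iff pair_finite_verts)
qed

text \<open>The binomial theorem indexed by subsets: expand the product of \<open>a + b\<close> over
  \<open>A\<close>, where \<open>X\<close> collects the factors contributing
  \<open>a\<close>.\<close>

lemma sum_Pow_power_card:
  fixes a b :: "'a :: comm_semiring_1"
  assumes "finite A"
  shows "(\<Sum>X\<in>Pow A. a ^ card X * b ^ (card A - card X)) = (a + b) ^ card A"
proof -
  have "(a + b) ^ card A = (\<Sum>X\<in>Pow A. (\<Prod>x\<in>X. a) * (\<Prod>x\<in>A - X. b))"
    using prod_add[OF assms, of "\<lambda>_. a" "\<lambda>_. b"] by simp
  also have "\<dots> = (\<Sum>X\<in>Pow A. a ^ card X * b ^ (card A - card X))"
    using assms by (intro sum.cong refl) (simp add: card_Diff_subset finite_subset)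
  finally show ?thesis by simp
qed

lemma monom_1_eq_power: "monom 1 n = [:0, 1:] ^ n"
  by (simp add: monom_altdef)

text \<open>\<open>S\<close> is the part inside \<open>G\<close> and \<open>R\<close> lists the
  vertices whose pendant is chosen. Pendants are pairwise non-adjacent, so the only constraint on
  \<open>R\<close> is to avoid \<open>S\<close>.\<close>

lemma bij_betw_stable_sets_pendant_graph:
  "bij_betw (\<lambda>(S, R). Inl ` S \<union> Inr ` R)
    (SIGMA S:{S. stable_set G S}. Pow (pverts G - S)) {S. stable_set (pendant_graph G) S}"
proof (rule bij_betw_byWitness[where f' = "\<lambda>X. (Inl -` X, Inr -` X)"])
  show "(\<lambda>(S, R). Inl ` S \<union> Inr ` R) ` (SIGMA S:{S. stable_set G S}. Pow (pverts G - S))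
      \<subseteq> {S. stable_set (pendant_graph G) S}"
    by (fastforce simp: stable_set_def)
  show "(\<lambda>X. (Inl -` X, Inr -` X)) ` {S. stable_set (pendant_graph G) S}
      \<subseteq> (SIGMA S:{S. stable_set G S}. Pow (pverts G - S))"
    unfolding stable_set_def pverts_pendant_graph by (fastforce simp del: pverts_pendant_graph)
  have "Inl ` Inl -` X \<union> Inr ` Inr -` X = X" for X :: "('a + 'a) set"
    by (auto simp: image_iff) (metis sumE)
  then show "\<forall>X\<in>{S. stable_set (pendant_graph G) S}.
      (case (Inl -` X, Inr -` X) of (S, R) \<Rightarrow> Inl ` S \<union> Inr ` R) = X"
    by simp
qed auto

text \<open>For a fixed \<open>S\<close>, every vertex outside \<open>S\<close> may or may not have
  its pendant chosen, which contributes a factor 1 + x.\<close>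

lemma indep_poly_pendant_graph:
  assumes "finite (pverts G)"
  shows "indep_poly (pendant_graph G) =
    (\<Sum>S | stable_set G S. [:0, 1:] ^ card S * [:1, 1:] ^ (card (pverts G) - card S))"
proof -
  have fin: "finite S" if "stable_set G S" for S
    using assms that by (rule stable_set_finite)
  have card: "card (Inl ` S \<union> Inr ` R :: ('a + 'a) set) = card S + card R"
    if "finite S" "finite R" for S R :: "'a set"
    using that by (subst card_Un_disjoint) (auto simp: card_image)
  have "indep_poly (pendant_graph G) = (\<Sum>X | stable_set (pendant_graph G) X. [:0, 1:] ^ card X)"
    using assms by (simp add: indep_poly_eq_sum_stable_sets monom_1_eq_power)
  also have "\<dots> = (\<Sum>(S, R)\<in>(SIGMA S:{S. stable_set G S}. Pow (pverts G - S)).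
      [:0, 1:] ^ card (Inl ` S \<union> Inr ` R :: ('a + 'a) set))"
    by (simp add: sum.reindex_bij_betw[OF bij_betw_stable_sets_pendant_graph, symmetric] case_prod_unfold)
  also have "\<dots> = (\<Sum>S | stable_set G S. \<Sum>R\<in>Pow (pverts G - S).
      [:0, 1:] ^ card (Inl ` S \<union> Inr ` R :: ('a + 'a) set))"
    using assms by (intro sum.Sigma[symmetric] finite_stable_sets) auto
  also have "\<dots> = (\<Sum>S | stable_set G S. [:0, 1:] ^ card S * (\<Sum>R\<in>Pow (pverts G - S). [:0, 1:] ^ card R))"
  proof (intro sum.cong refl)
    fix S assume "S \<in> {S. stable_set G S}"
    then have "finite S" by (simp add: fin)
    then show "(\<Sum>R\<in>Pow (pverts G - S). [:0, 1:] ^ card (Inl ` S \<union> Inr ` R :: ('a + 'a) set)) =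
        [:0, 1:] ^ card S * (\<Sum>R\<in>Pow (pverts G - S). [:0, 1:: real:] ^ card R)"
      using assms unfolding sum_distrib_left
      by (intro sum.cong refl) (metis PowD card finite_Diff finite_subset power_add)
  qed
  also have "\<dots> = (\<Sum>S | stable_set G S. [:0, 1:] ^ card S * [:1, 1:] ^ (card (pverts G) - card S))"
  proof (intro sum.cong refl arg_cong2[where f = "(*)"])
    fix S assume S: "S \<in> {S. stable_set G S}"
    have "(\<Sum>R\<in>Pow (pverts G - S). [:0, 1::real:] ^ card R) = ([:0, 1:] + 1) ^ card (pverts G - S)"
      using sum_Pow_power_card[of "pverts G - S" "[:0, 1::real:]" 1] assms by simp
    also have "[:0, 1:] + 1 = [:1, 1::real:]"
      by (simp add: one_pCons)
    also have "card (pverts G - S) = card (pverts G) - card S"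
      using S fin by (intro card_Diff_subset) (auto simp: stable_set_def)
    finally show "(\<Sum>R\<in>Pow (pverts G - S). [:0, 1::real:] ^ card R) = [:1, 1:] ^ (card (pverts G) - card S)" .
  qed
  finally show ?thesis .
qed

section \<open>Independence number and the multiplicity of -1\<close>

definition indep_number :: "'a pair_pre_digraph \<Rightarrow> nat" where
  "indep_number G = Max (card ` {S. stable_set G S})"

lemma card_le_indep_number:
  assumes "finite (pverts G)" "stable_set G S"
  shows "card S \<le> indep_number G"
  unfolding indep_number_def using assms by (intro Max_ge) (auto simp: finite_stable_sets)

lemma indep_number_witness:
  assumes "finite (pverts G)"
  obtains S where "stable_set G S" "card S = indep_number G"
proof -
  have "indep_number G \<in> card ` {S. stable_set G S}"
    unfolding indep_number_def using assms
    by (intro Max_in) (auto simp: finite_stable_sets intro: exI[of _ "{}"])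
  then show ?thesis using that by auto
qed

text \<open>Every summand contains the factor 1 + x at least n - \<alpha> times; the cofactor
  \<open>q\<close> left after extracting that power does not vanish at -1.\<close>

lemma order_indep_poly_pendant_graph:
  assumes "finite (pverts G)"
  shows "order (-1) (indep_poly (pendant_graph G)) = card (pverts G) - indep_number G"
proof -
  let ?a = "indep_number G"
  define q :: "real poly" where "q = (\<Sum>S | stable_set G S. [:0, 1:] ^ card S * [:1, 1:] ^ (?a - card S))"
  obtain M where M: "stable_set G M" "card M = ?a"
    using assms by (rule indep_number_witness)
  have a_le: "?a \<le> card (pverts G)"
    using M card_stable_set_le[OF assms] by metis
  have "indep_poly (pendant_graph G) = [:1, 1:] ^ (card (pverts G) - ?a) * q"
    unfolding q_def indep_poly_pendant_graph[OF assms] sum_distrib_left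
  proof (intro sum.cong refl)
    fix S assume "S \<in> {S. stable_set G S}"
    then have "card S \<le> ?a"
      using assms by (simp add: card_le_indep_number)
    then have "card (pverts G) - card S = (card (pverts G) - ?a) + (?a - card S)"
      using a_le by simp
    then show "[:0, 1:] ^ card S * [:1, 1::real:] ^ (card (pverts G) - card S) =
        [:1, 1:] ^ (card (pverts G) - ?a) * ([:0, 1:] ^ card S * [:1, 1:] ^ (?a - card S))"
      by (simp only: power_add ac_simps)
  qed
  \<comment> \<open>At -1 the factor 1 + x kills all terms except those of maximum stable sets.
    These all carry the same sign, so nothing cancels.\<close>
  moreover have "poly q (-1) \<noteq> 0"
  proof -
    have "poly q (-1) = (\<Sum>S | stable_set G S. (-1) ^ card S * 0 ^ (?a - card S))"
      by (simp add: q_def poly_sum)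
    also have "\<dots> = (\<Sum>S | stable_set G S. if card S = ?a then (-1) ^ ?a else 0)"
      using card_le_indep_number[OF assms] by (intro sum.cong refl) (auto simp: zero_power le_neq_implies_less)
    also have "\<dots> = of_nat (card {S. stable_set G S \<and> card S = ?a}) * (-1) ^ ?a"
      using finite_stable_sets[OF assms] by (simp add: sum.If_cases Int_def)
    finally have "poly q (-1) = \<dots>" .
    moreover have "card {S. stable_set G S \<and> card S = ?a} \<noteq> 0"
      using M finite_stable_sets[OF assms] by (auto simp: card_eq_0_iff)
    ultimately show ?thesis by simp
  qed
  moreover from this have "q \<noteq> 0" by auto
  ultimately show ?thesis
    using order_power_n_n[of "-1 :: real" "card (pverts G) - ?a"]
    by (simp add: order_mult order_0I)
qed

section \<open>Pendant graphs of stars\<close>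

text \<open>The parameter \<open>c\<close> covers both powers needed for the star, those of 1 + x
  and of 1 + 2x.\<close>

lemma linear_poly_power:
  fixes c :: "'a :: comm_ring_1"
  shows "[:1, c:] ^ n = (\<Sum>k\<le>n. monom (of_nat (n choose k) * c ^ k) k)"
proof -
  have "[:1, c:] = monom c 1 + 1"
    by (simp add: monom_altdef one_pCons)
  then show ?thesis
    by (simp add: binomial_ring monom_power of_nat_monom mult_monom)
qed

lemma stable_sets_star:
  assumes "n \<ge> 1"
  shows "{S. stable_set (star n) S} = insert {0} (Pow {1..n})"
proof (intro equalityI subsetI)
  fix S assume "S \<in> {S. stable_set (star n) S}"
  then have S: "S \<subseteq> {0..n}" "\<And>u v. u \<in> S \<Longrightarrow> v \<in> S \<Longrightarrow> (u, v) \<notin> {0} \<times> {1..n}"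
    by (auto simp: stable_set_def star_def)
  show "S \<in> insert {0} (Pow {1..n})"
  proof (cases "0 \<in> S")
    case True
    then have "v = 0" if "v \<in> S" for v
      using S(1) S(2)[of 0 v] that by (cases v) auto
    with True show ?thesis by auto
  next
    case False
    have "S \<subseteq> {1..n}"
    proof
      fix v assume "v \<in> S"
      with S(1) False show "v \<in> {1..n}" by (cases v) auto
    qed
    then show ?thesis by simp
  qed
next
  fix S assume "S \<in> insert {0} (Pow {1..n})"
  then show "S \<in> {S. stable_set (star n) S}"
    by (fastforce simp: stable_set_def star_def)
qed

text \<open>The stable set \<open>{0}\<close> contributes x (1 + x)^n, and the sets of leaves
  together contribute (1 + x) (1 + 2x)^n. Extracting 1 + x leaves (1 + 2x)^n + x (1 + x)^(n-1),
  whose expansions give the two binomial coefficients.\<close>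

lemma indep_poly_pendant_star:
  assumes "n \<ge> 1"
  shows "indep_poly (pendant_graph (star n)) =
    [:1, 1:] * (1 + (\<Sum>k=1..n. monom (of_nat ((n choose k) * 2 ^ k + ((n - 1) choose (k - 1)))) k))"
proof -
  obtain m where n: "n = Suc m"
    using assms by (cases n) auto
  have V: "pverts (star n) = {0..n}"
    by (simp add: star_def)
  have "indep_poly (pendant_graph (star n)) = (\<Sum>S\<in>insert {0} (Pow {1..n}).
      [:0, 1:] ^ card S * [:1, 1:] ^ (Suc n - card S))"
    using assms by (simp add: indep_poly_pendant_graph V stable_sets_star)
  also have "\<dots> = [:0, 1:] * [:1, 1:] ^ n + (\<Sum>S\<in>Pow {1..n}. [:0, 1:] ^ card S * [:1, 1:] ^ (Suc n - card S))"
    by (subst sum.insert) auto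
  \<comment> \<open>The star has n + 1 vertices. The extra factor 1 + x belongs to the pendant at
    the centre, which is free when \<open>S\<close> consists of leaves.\<close>
  also have "(\<Sum>S\<in>Pow {1..n}. [:0, 1::real:] ^ card S * [:1, 1:] ^ (Suc n - card S)) =
      [:1, 1:] * (\<Sum>S\<in>Pow {1..n}. [:0, 1:] ^ card S * [:1, 1:] ^ (card {1..n} - card S))"
    unfolding sum_distrib_left
  proof (intro sum.cong refl)
    fix S assume "S \<in> Pow {1..n}"
    then have "card S \<le> card {1..n}"
      by (intro card_mono) auto
    then have "Suc n - card S = Suc (card {1..n} - card S)"
      by simp
    then show "[:0, 1::real:] ^ card S * [:1, 1:] ^ (Suc n - card S) =
        [:1, 1:] * ([:0, 1:] ^ card S * [:1, 1:] ^ (card {1..n} - card S))"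
      by (simp only: power_Suc ac_simps)
  qed
  \<comment> \<open>The subset form of the binomial theorem with \<open>a\<close> = x and
    \<open>b\<close> = 1 + x.\<close>
  also have "(\<Sum>S\<in>Pow {1..n}. [:0, 1::real:] ^ card S * [:1, 1:] ^ (card {1..n} - card S)) = [:1, 2:] ^ n"
    by (subst sum_Pow_power_card) auto
  also have "[:0, 1:] * [:1, 1:] ^ n + [:1, 1:] * [:1, 2:] ^ n = [:1, 1:] * ([:1, 2:] ^ n + [:0, 1::real:] * [:1, 1:] ^ m)"
    unfolding n power_Suc by (simp only: algebra_simps)
  also have "[:1, 2::real:] ^ n = 1 + (\<Sum>k=1..n. monom (of_nat ((n choose k) * 2 ^ k)) k)"
    unfolding linear_poly_power sum.atMost_shift by (simp add: sum.atLeast1_atMost_eq)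
  \<comment> \<open>The factor x shifts the exponents by one, whence the k - 1 in the lower
    index.\<close>
  also have "[:0, 1:] * [:1, 1::real:] ^ m = (\<Sum>k=1..n. monom (of_nat ((n - 1) choose (k - 1))) k)"
  proof -
    have "[:0, 1:] * [:1, 1::real:] ^ m = monom 1 1 * (\<Sum>k\<le>m. monom (of_nat (m choose k)) k)"
      unfolding linear_poly_power by (simp add: monom_altdef)
    also have "\<dots> = (\<Sum>k\<le>m. monom (of_nat (m choose k)) (Suc k))"
      by (simp add: sum_distrib_left mult_monom)
    finally show ?thesis
      by (simp add: n sum.atLeast1_atMost_eq flip: lessThan_Suc_atMost)
  qed
  finally show ?thesis
    by (simp add: add.assoc add_monom flip: sum.distrib)
qed

text \<open>The set of all leaves is a largest stable set. The bound on \<open>n\<close> matters: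
  for \<open>star 0\<close> the singleton \<open>{0}\<close> is larger than the empty set of
  leaves.\<close>

lemma indep_number_star:
  assumes "n \<ge> 1"
  shows "indep_number (star n) = n"
proof -
  have "card S \<le> n" if "S \<in> insert {0} (Pow {1..n})" for S
    using that assms card_mono[of "{1..n}" S] by auto
  moreover have "n \<in> card ` insert {0} (Pow {1..n})"
    by (rule image_eqI[of _ _ "{1..n}"]) simp_all
  ultimately show ?thesis
    unfolding indep_number_def stable_sets_star[OF assms] by (intro Max_eqI) blast+
qed

lemma order_indep_poly_pendant_star:
  assumes "n \<ge> 1"
  shows "order (-1) (indep_poly (pendant_graph (star n))) = 1"
  using order_indep_poly_pendant_graph[of "star n"] indep_number_star[OF assms] by (simp add: star_def)

text \<open>A maximal stable set meets each pair of a vertex and its pendant exactly once: at most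
  once because they are adjacent, and at least once because otherwise the pendant could be
  added.\<close>

lemma well_covered_pendant_graph:
  fixes G :: "'a pair_pre_digraph"
  shows "well_covered (pendant_graph G)"
proof -
  have "card S = card (pverts G)" if "maximal_stable_set (pendant_graph G) S" for S
  proof -
    \<comment> \<open>\<open>?p\<close> sends a vertex and its pendant to the same vertex of
      \<open>G\<close>; it will be a bijection from \<open>S\<close> onto
      \<open>pverts G\<close>.\<close>
    let ?p = "case_sum id id :: 'a + 'a \<Rightarrow> 'a"
    from that have S: "S \<subseteq> Inl ` pverts G \<union> Inr ` pverts G"
        "\<And>u v. u \<in> S \<Longrightarrow> v \<in> S \<Longrightarrow> (u, v) \<notin> parcs (pendant_graph G)"
      and max: "\<And>S'. stable_set (pendant_graph G) S' \<Longrightarrow> S \<subseteq> S' \<Longrightarrow> S' = S"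
      by (auto simp: maximal_stable_set_def stable_set_def)
    have not_both: "\<not> (Inl v \<in> S \<and> Inr v \<in> S)" for v
      using S(1) S(2)[of "Inl v" "Inr v"] by auto
    have "inj_on ?p S"
    proof (rule inj_onI)
      fix x y assume "x \<in> S" "y \<in> S" "?p x = ?p y"
      then show "x = y"
        using not_both by (cases x; cases y) auto
    qed
    moreover have "?p ` S = pverts G"
    proof (intro equalityI subsetI)
      fix v assume v: "v \<in> pverts G"
      have "Inl v \<in> S \<or> Inr v \<in> S"
      proof (rule ccontr)
        assume not: "\<not> (Inl v \<in> S \<or> Inr v \<in> S)"
        have "(Inr v, u) \<notin> parcs (pendant_graph G)" "(u, Inr v) \<notin> parcs (pendant_graph G)"
          if "u \<in> insert (Inr v) S" for u
          using not that by (cases u; auto)+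
        then have "stable_set (pendant_graph G) (insert (Inr v) S)"
          using S v by (auto simp: stable_set_def)
        with max not show False by blast
      qed
      then show "v \<in> ?p ` S" by force
    qed (use S in auto)
    ultimately show ?thesis by (metis card_image)
  qed
  then show ?thesis by (simp add: well_covered_def)
qed

section \<open>Stars and connectivity\<close>

text \<open>Send 0 to \<open>c\<close> and enumerate \<open>S\<close> by the leaves. An empty
  \<open>S\<close> is allowed and gives the single vertex \<open>star 0\<close>.\<close>

lemma graph_iso_star:
  assumes "pair_graph G" "pverts G = insert c S" "c \<notin> S" "parcs G = {c} \<times> S \<union> S \<times> {c}"
  shows "graph_iso G (star (card S))"
proof -
  interpret pair_graph G by fact
  have "finite S"
    using assms pair_finite_verts by simp
  then obtain h where h: "bij_betw h {1..card S} S"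
    using ex_bij_betw_nat_finite_1 by blast
  let ?f = "\<lambda>i. if i = 0 then c else h i"
  have h_in: "h i \<in> S" if "i \<in> {1..card S}" for i
    using h that by (auto simp: bij_betw_def)
  have "bij_betw ?f {1..card S} S"
    using h by (subst bij_betw_cong[of _ _ h]) auto
  then have "bij_betw ?f ({1..card S} \<union> {0}) (S \<union> {c})"
    using assms(3) by (intro bij_betw_combine) auto
  moreover have "{1..card S} \<union> {0} = {0..card S}"
    by auto
  ultimately have "bij_betw ?f (pverts (star (card S))) (pverts G)"
    using assms(2) by (simp add: star_def)
  moreover have "(u, v) \<in> parcs (star (card S)) \<longleftrightarrow> (?f u, ?f v) \<in> parcs G"
    if "u \<in> {0..card S}" "v \<in> {0..card S}" for u v
    using that h_in[of u] h_in[of v] assms(3) unfolding assms(4) star_def by (auto simp: Suc_le_eq)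
  ultimately have "graph_iso (star (card S)) G"
    unfolding graph_iso_iff_bij_betw[OF pair_graph_star assms(1)]
    by (intro exI[of _ ?f]) (auto simp: star_def)
  then show ?thesis
    using assms(1) pair_graph_star graph_iso_sym by blast
qed

text \<open>Induction along a walk from \<open>a\<close> never leaves \<open>A\<close>. Connectivity
  is used below only through this principle of closed sets.\<close>

lemma graph_connected_closed_set:
  assumes "pair_graph G" "graph_connected G" "a \<in> A" "a \<in> pverts G"
    and closed: "\<And>u v. u \<in> A \<Longrightarrow> (u, v) \<in> parcs G \<Longrightarrow> v \<in> A"
  shows "pverts G \<subseteq> A"
proof
  interpret pair_graph G by fact
  fix v assume "v \<in> pverts G"
  moreover have "strongly_connected (with_proj G)"
    using assms(2) pair_sym_arcs symmetric_connected_imp_strongly_connected by (simp add: graph_connected_def)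
  ultimately have "a \<rightarrow>\<^sup>*\<^bsub>with_proj G\<^esub> v"
    using assms(4) by auto
  then obtain p where "awalk a p v"
    using reachable_awalk by blast
  with \<open>a \<in> A\<close> show "v \<in> A"
    by (induction p arbitrary: a) (auto simp: awalk_simps dest: closed)
qed

text \<open>The converse principle: applied to the set of vertices reachable from \<open>c\<close>,
  it yields walks through \<open>c\<close> between any two vertices.\<close>

lemma graph_connectedI:
  assumes "pair_graph G" "c \<in> pverts G"
    and closed: "\<And>A. c \<in> A \<Longrightarrow> (\<And>u v. u \<in> A \<Longrightarrow> (u, v) \<in> parcs G \<Longrightarrow> v \<in> A) \<Longrightarrow> pverts G \<subseteq> A"
  shows "graph_connected G"
proof -
  interpret pair_graph G by fact
  have "pverts G \<subseteq> {v. c \<rightarrow>\<^sup>*\<^bsub>with_proj G\<^esub> v}"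
  proof (rule closed)
    show "c \<in> {v. c \<rightarrow>\<^sup>*\<^bsub>with_proj G\<^esub> v}"
      using assms(2) by (simp add: reachable_refl)
    show "v \<in> {v. c \<rightarrow>\<^sup>*\<^bsub>with_proj G\<^esub> v}" if "u \<in> {v. c \<rightarrow>\<^sup>*\<^bsub>with_proj G\<^esub> v}" "(u, v) \<in> parcs G" for u v
      using that reachable_adj_trans by auto
  qed
  then have c: "c \<rightarrow>\<^sup>*\<^bsub>with_proj G\<^esub> v" if "v \<in> pverts G" for v
    using that by auto
  have "u \<rightarrow>\<^sup>*\<^bsub>with_proj G\<^esub> v" if "u \<in> pverts G" "v \<in> pverts G" for u v
    using symmetric_reachable[OF pair_sym_arcs c[OF that(1)]] c[OF that(2)] by (rule reachable_trans)
  \<comment> \<open>Connectedness is defined as strong connectedness of the symmetric closure, so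
    reachability is moved there.\<close>
  then have "u \<rightarrow>\<^sup>*\<^bsub>with_proj (mk_symmetric (with_proj G))\<^esub> v" if "u \<in> pverts G" "v \<in> pverts G" for u v
    using that by (simp add: reachable_mk_symmetricI)
  then show ?thesis
    using assms(2) unfolding graph_connected_def Digraph_Component.connected_def
    by (intro strongly_connectedI) auto
qed

text \<open>
  \<open>S\<close> misses a single vertex \<open>c\<close>, and a vertex of \<open>S\<close> not adjacent to \<open>c\<close> would be cut off
  together with its pendant vertex.
\<close>

lemma graph_iso_star_if_large_stable_set:
  assumes "pair_graph G" "graph_connected (pendant_graph G)"
    and S: "stable_set G S" "card (pverts G) = Suc (card S)"
  shows "graph_iso G (star (card S))"
proof -
  interpret pair_graph G by fact
  have sub: "S \<subseteq> pverts G" and stable: "\<And>u v. u \<in> S \<Longrightarrow> v \<in> S \<Longrightarrow> (u, v) \<notin> parcs G"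
    using S(1) by (auto simp: stable_set_def)
  have "card (pverts G - S) = 1"
    using S(2) sub pair_finite_verts by (simp add: card_Diff_subset finite_subset)
  then obtain c where c: "pverts G - S = {c}"
    by (auto simp: card_1_singleton_iff)
  then have V: "pverts G = insert c S" and "c \<notin> S"
    using sub by auto
  have adj: "(s, c) \<in> parcs G" if "s \<in> S" for s
  proof (rule ccontr)
    assume "(s, c) \<notin> parcs G"
    then have "(s, v) \<notin> parcs G" for v
      using stable[OF that, of v] V in_arcsD2[of s v] by auto
    then have "v \<in> {Inl s, Inr s}" if "u \<in> {Inl s, Inr s}" "(u, v) \<in> parcs (pendant_graph G)" for u v
      using that by (cases v) auto
    then have "pverts (pendant_graph G) \<subseteq> {Inl s, Inr s}"
      using assms that sub
      by (intro graph_connected_closed_set[of _ "Inl s"] pair_graph_pendant_graph) auto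
    with V that \<open>c \<notin> S\<close> show False by auto
  qed
  have "parcs G = {c} \<times> S \<union> S \<times> {c}"
  proof (intro equalityI subsetI)
    fix e assume e: "e \<in> parcs G"
    then have "fst e \<in> insert c S" "snd e \<in> insert c S" "fst e \<noteq> snd e"
      using V arc_fst_in_verts arc_snd_in_verts pair_no_loops by auto
    then show "e \<in> {c} \<times> S \<union> S \<times> {c}"
      using e stable by (cases e) auto
  qed (use adj arcs_symmetric in auto)
  then show ?thesis
    using assms(1) V \<open>c \<notin> S\<close> by (intro graph_iso_star)
qed

text \<open>By the multiplicity formula, order 1 means \<alpha>(G) = n - 1, so a maximum stable set
  misses exactly one vertex.\<close>

lemma order_eq_1_iff_star:
  assumes "pair_graph G" "graph_connected (pendant_graph G)"
  shows "order (-1) (indep_poly (pendant_graph G)) = 1 \<longleftrightarrow> (\<exists>n\<ge>1. graph_iso G (star n))"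
proof
  interpret pair_graph G by fact
  assume "order (-1) (indep_poly (pendant_graph G)) = 1"
  then have order: "card (pverts G) - indep_number G = 1"
    by (simp add: order_indep_poly_pendant_graph pair_finite_verts)
  obtain S where S: "stable_set G S" "card S = indep_number G"
    using pair_finite_verts by (rule indep_number_witness)
  \<comment> \<open>A positive order makes \<open>G\<close> non-empty, hence \<alpha>(G) is at least
    1 and the star obtained has at least one leaf.\<close>
  obtain v where v: "v \<in> pverts G"
    using order by fastforce
  then have "stable_set G {v}"
    using pair_no_loops[of "(v, v)"] by (auto simp: stable_set_def)
  then have "1 \<le> indep_number G"
    using card_le_indep_number[OF pair_finite_verts] by fastforce
  moreover have "graph_iso G (star (card S))"
    using assms S order by (intro graph_iso_star_if_large_stable_set) auto
  ultimately show "\<exists>n\<ge>1. graph_iso G (star n)"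
    using S(2) by auto
next
  assume "\<exists>n\<ge>1. graph_iso G (star n)"
  then obtain n where n: "n \<ge> 1" "graph_iso G (star n)"
    by auto
  then have "indep_poly (pendant_graph G) = indep_poly (pendant_graph (star n))"
    using assms(1) pair_graph_star
    by (intro indep_poly_cong_graph_iso pair_graph_pendant_graph graph_iso_pendant_graph)
  then show "order (-1) (indep_poly (pendant_graph G)) = 1"
    using order_indep_poly_pendant_star[OF n(1)] by simp
qed

section \<open>Well-covered spiders\<close>

lemma maximal_stable_set_extension:
  assumes "finite (pverts G)" "stable_set G S"
  obtains M where "maximal_stable_set G M" "S \<subseteq> M"
proof -
  have "finite {M. stable_set G M \<and> S \<subseteq> M}"
    using finite_stable_sets[OF assms(1)] by (rule rev_finite_subset) auto
  then obtain M where "M \<in> {M. stable_set G M \<and> S \<subseteq> M}"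
    and max: "\<forall>N\<in>{M. stable_set G M \<and> S \<subseteq> M}. M \<subseteq> N \<longrightarrow> M = N"
    using assms(2) finite_has_maximal[of "{M. stable_set G M \<and> S \<subseteq> M}"] by auto
  then have "maximal_stable_set G M"
    unfolding maximal_stable_set_def by blast
  then show ?thesis
    using that \<open>M \<in> _\<close> by simp
qed

text \<open>
  If \<open>M\<close> is a maximal stable set containing \<open>C\<close>, then replacing \<open>A\<close> by \<open>B\<close> in \<open>M\<close> yields a stable set again.
\<close>

lemma well_covered_exchange:
  assumes "pair_graph G" "well_covered G" and C: "stable_set G C" "A \<subseteq> C" and B: "stable_set G B"
    and dom: "\<And>b. b \<in> B \<Longrightarrow> b \<in> A \<or> (\<exists>x\<in>C. (b, x) \<in> parcs G)"
    and nbr: "\<And>b v. b \<in> B \<Longrightarrow> (b, v) \<in> parcs G \<Longrightarrow> v \<in> A \<or> (\<exists>x\<in>C. (v, x) \<in> parcs G)"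
  shows "card B \<le> card A"
proof -
  interpret pair_graph G by fact
  obtain M where M: "maximal_stable_set G M" "C \<subseteq> M"
    using pair_finite_verts C(1) by (rule maximal_stable_set_extension)
  then have M_stable: "stable_set G M"
    by (simp add: maximal_stable_set_def)
  then have M_adj: "(u, v) \<notin> parcs G" if "u \<in> M" "v \<in> M" for u v
    using that by (simp add: stable_set_def)
  have fin: "finite M" "finite B"
    using M_stable B by (auto intro: stable_set_finite[OF pair_finite_verts])
  \<comment> \<open>A neighbour of \<open>b\<close> outside \<open>A\<close> has a neighbour in
    \<open>C\<close>, which lies in \<open>M\<close>, and so cannot itself belong to the stable set
    \<open>M\<close>.\<close>
  have cross: "(b, v) \<notin> parcs G" if "b \<in> B" "v \<in> M - A" for b v
    using nbr[of b v] that M_adj M(2) by blast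
  have "stable_set G ((M - A) \<union> B)"
    unfolding stable_set_def
  proof (intro conjI ballI)
    show "M - A \<union> B \<subseteq> pverts G"
      using M_stable B by (auto simp: stable_set_def)
    show "(u, v) \<notin> parcs G" if "u \<in> M - A \<union> B" "v \<in> M - A \<union> B" for u v
      using that M_adj cross[of u v] cross[of v u] B arcs_symmetric[of u v] by (auto simp: stable_set_def)
  qed
  \<comment> \<open>The exchanged set need not be maximal. It is extended to a maximal one, whose
    size equals that of \<open>M\<close> by well-coveredness.\<close>
  then obtain N where N: "maximal_stable_set G N" "(M - A) \<union> B \<subseteq> N"
    using pair_finite_verts maximal_stable_set_extension by blast
  have "(M - A) \<inter> B = {}"
    using dom M_adj M(2) by blast
  then have "card (M - A) + card B = card ((M - A) \<union> B)"
    using fin by (simp add: card_Un_disjoint)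
  also have "\<dots> \<le> card N"
    using N stable_set_finite[OF pair_finite_verts] by (intro card_mono) (auto simp: maximal_stable_set_def)
  also have "card N = card M"
    using assms(2) M(1) N(1) unfolding well_covered_def by blast
  also have "card M = card (M - A) + card A"
    using card_Int_Diff[OF fin(1), of A] C(2) M(2) by (simp add: Int_absorb1)
  finally show ?thesis by simp
qed

section \<open>Neighbourhoods\<close>

definition nbrs :: "'a pair_pre_digraph \<Rightarrow> 'a \<Rightarrow> 'a set" where
  "nbrs G v = {u. (v, u) \<in> parcs G}"

lemma finite_nbrs:
  assumes "pair_graph G"
  shows "finite (nbrs G v)"
proof -
  interpret pair_graph G by fact
  have "nbrs G v \<subseteq> pverts G"
    by (auto simp: nbrs_def dest: in_arcsD2)
  then show ?thesis
    using pair_finite_verts by (rule finite_subset)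
qed

lemma nbrs_sym:
  assumes "pair_graph G"
  shows "u \<in> nbrs G v \<longleftrightarrow> v \<in> nbrs G u"
proof -
  interpret pair_graph G by fact
  show ?thesis
    using arcs_symmetric by (auto simp: nbrs_def)
qed

lemma not_in_nbrs_self:
  assumes "pair_graph G"
  shows "v \<notin> nbrs G v"
proof -
  interpret pair_graph G by fact
  show ?thesis
    using pair_no_loops[of "(v, v)"] by (auto simp: nbrs_def)
qed

lemma nbrs_in_verts:
  assumes "pair_graph G" "u \<in> nbrs G v"
  shows "u \<in> pverts G" "v \<in> pverts G"
proof -
  interpret pair_graph G by fact
  show "u \<in> pverts G" "v \<in> pverts G"
    using assms(2) by (auto simp: nbrs_def dest: in_arcsD1 in_arcsD2)
qed

lemma out_degree_eq_card_nbrs: "out_degree (with_proj G) v = card (nbrs G v)"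
proof -
  have "out_arcs (with_proj G) v = Pair v ` nbrs G v"
    by (auto simp: out_arcs_def nbrs_def)
  then show ?thesis
    by (simp add: out_degree_def card_image inj_on_def)
qed

lemma stable_set_nbrs_iff:
  "stable_set G S \<longleftrightarrow> S \<subseteq> pverts G \<and> (\<forall>u\<in>S. nbrs G u \<inter> S = {})"
  by (auto simp: stable_set_def nbrs_def)

text \<open>The exchange argument phrased for explicitly known neighbourhoods: \<open>C\<close> is
  forced into a maximal stable set, \<open>A\<close> is removed from it and \<open>B\<close> takes
  its place.\<close>

lemma well_covered_exchange_nbrs:
  assumes "pair_graph G" "well_covered G" "stable_set G C" "A \<subseteq> C" "stable_set G B"
    and "\<And>b. b \<in> B \<Longrightarrow> b \<in> A \<or> nbrs G b \<inter> C \<noteq> {}"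
    and "\<And>b v. b \<in> B \<Longrightarrow> v \<in> nbrs G b \<Longrightarrow> v \<in> A \<or> nbrs G v \<inter> C \<noteq> {}"
  shows "card B \<le> card A"
  using assms(1-5)
proof (rule well_covered_exchange)
  show "b \<in> A \<or> (\<exists>x\<in>C. (b, x) \<in> parcs G)" if "b \<in> B" for b
    using assms(6)[OF that] by (auto simp: nbrs_def)
  show "v \<in> A \<or> (\<exists>x\<in>C. (v, x) \<in> parcs G)" if "b \<in> B" "(b, v) \<in> parcs G" for b v
    using assms(7)[OF that(1), of v] that(2) by (auto simp: nbrs_def)
qed

section \<open>Cycles and paths as lists of vertices\<close>

text \<open>The library describes cycles by arc lists. Here the vertices are listed once each, and
  the length bound rules out going back and forth along one edge.\<close>

definition vertex_cycle :: "'a pair_pre_digraph \<Rightarrow> 'a list \<Rightarrow> bool" where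
  "vertex_cycle G xs \<longleftrightarrow> length xs \<ge> 3 \<and> distinct xs \<and>
    successively (\<lambda>u v. (u, v) \<in> parcs G) xs \<and> (last xs, hd xs) \<in> parcs G"

lemma awalk_zip_tl:
  assumes "pair_graph G" "xs \<noteq> []" "set xs \<subseteq> pverts G" "successively (\<lambda>u v. (u, v) \<in> parcs G) xs"
  shows "pre_digraph.awalk (with_proj G) (hd xs) (zip xs (tl xs)) (last xs)"
    and "pawalk_verts (hd xs) (zip xs (tl xs)) = xs"
proof -
  interpret pair_graph G by fact
  show "awalk (hd xs) (zip xs (tl xs)) (last xs)" "pawalk_verts (hd xs) (zip xs (tl xs)) = xs"
    using assms(2-) by (induction xs rule: induct_list012) (auto simp: awalk_simps)
qed

lemma successively_awalk_verts:
  assumes "pair_graph G" "pre_digraph.awalk (with_proj G) u p v"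
  shows "successively (\<lambda>u v. (u, v) \<in> parcs G) (pawalk_verts u p)"
    and "hd (pawalk_verts u p) = u" and "last (pawalk_verts u p) = v"
proof -
  interpret pair_graph G by fact
  show "hd (pawalk_verts u p) = u" "last (pawalk_verts u p) = v"
    using assms(2) by simp_all
  have hd: "hd (pawalk_verts u p) = u" if "awalk u p v" for u p
    using that by simp
  show "successively (\<lambda>u v. (u, v) \<in> parcs G) (pawalk_verts u p)"
    using assms(2) by (induction p arbitrary: u) (auto simp: awalk_simps successively_Cons hd)
qed

text \<open>The vertex list of a closed walk repeats its first vertex at the end. Dropping the first
  entry gives a vertex cycle; conversely, the last vertex is put in front.\<close>

lemma ex_long_cycle_iff_vertex_cycle:
  assumes "pair_graph G"
  shows "(\<exists>p. pre_digraph.cycle (with_proj G) p \<and> length p \<ge> 3) \<longleftrightarrow> (\<exists>xs. vertex_cycle G xs)"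
proof -
  interpret pair_graph G by fact
  show ?thesis
  proof
    assume "\<exists>p. cycle p \<and> length p \<ge> 3"
    then obtain p u where p: "length p \<ge> 3" "awalk u p u" "distinct (tl (pawalk_verts u p))"
      by (auto simp: cycle_def)
    note walk = successively_awalk_verts[OF assms p(2)]
    have "length (pawalk_verts u p) = Suc (length p)"
      by (rule length_awalk_verts)
    then obtain x xs where xs: "pawalk_verts u p = x # xs" "length xs = length p"
      by (cases "pawalk_verts u p") auto
    with p(1) have "xs \<noteq> []" by auto
    with p xs walk have "vertex_cycle G xs"
      by (auto simp: vertex_cycle_def successively_Cons)
    then show "\<exists>xs. vertex_cycle G xs" ..
  next
    assume "\<exists>xs. vertex_cycle G xs"
    then obtain xs where xs: "vertex_cycle G xs" ..
    then have "xs \<noteq> []"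
      by (auto simp: vertex_cycle_def)
    define ys where "ys = last xs # xs"
    have succ: "successively (\<lambda>u v. (u, v) \<in> parcs G) ys"
      using xs by (auto simp: ys_def vertex_cycle_def successively_Cons)
    have "set xs \<subseteq> pverts G"
    proof
      fix x assume "x \<in> set xs"
      then obtain i where "i < length xs" "x = xs ! i"
        by (auto simp: in_set_conv_nth)
      then have "(ys ! i, x) \<in> parcs G"
        using successively_nth[OF succ, of i] by (simp add: ys_def)
      then show "x \<in> pverts G" by (rule in_arcsD2)
    qed
    then have sub: "set ys \<subseteq> pverts G"
      using \<open>xs \<noteq> []\<close> by (auto simp: ys_def)
    have "ys \<noteq> []" "hd ys = last xs" "last ys = last xs"
      using \<open>xs \<noteq> []\<close> by (simp_all add: ys_def)
    with awalk_zip_tl[OF assms _ sub succ]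
    have "awalk (last xs) (zip ys (tl ys)) (last xs)" "pawalk_verts (last xs) (zip ys (tl ys)) = ys"
      by auto
    moreover have "distinct (tl ys)" "length (zip ys (tl ys)) \<ge> 3"
      using xs by (auto simp: ys_def vertex_cycle_def)
    moreover have "zip ys (tl ys) \<noteq> []"
      using \<open>xs \<noteq> []\<close> by (cases xs) (auto simp: ys_def)
    ultimately have "cycle (zip ys (tl ys))"
      unfolding cycle_def by metis
    then show "\<exists>p. cycle p \<and> length p \<ge> 3"
      using \<open>length (zip ys (tl ys)) \<ge> 3\<close> by blast
  qed
qed

lemma graph_tree_iff:
  "graph_tree G \<longleftrightarrow> pair_graph G \<and> graph_connected G \<and> \<not> (\<exists>xs. vertex_cycle G xs)"
  using ex_long_cycle_iff_vertex_cycle unfolding graph_tree_def by blast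

text \<open>These are the successor and the predecessor of \<open>x\<close> on the cycle; they
  differ because the cycle has at least three vertices.\<close>

lemma vertex_cycle_two_nbrs:
  assumes "pair_graph G" "vertex_cycle G xs" "x \<in> set xs"
  obtains y z where "y \<in> set xs" "z \<in> set xs" "y \<noteq> z" "y \<in> nbrs G x" "z \<in> nbrs G x"
proof -
  interpret pair_graph G by fact
  obtain us vs where xs: "xs = us @ x # vs"
    using assms(3) by (meson split_list)
  \<comment> \<open>The cycle read from just after \<open>x\<close> round to just before
    \<open>x\<close>; its two ends are the required neighbours.\<close>
  let ?ws = "vs @ us"
  have cyc: "length xs \<ge> 3" "distinct xs" "successively (\<lambda>u v. (u, v) \<in> parcs G) xs" "(last xs, hd xs) \<in> parcs G"
    using assms(2) by (auto simp: vertex_cycle_def)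
  have len: "length ?ws \<ge> 2" "distinct ?ws" "set ?ws \<subseteq> set xs"
    using cyc xs by auto
  then have "?ws \<noteq> []" by auto
  have "(x, hd ?ws) \<in> parcs G"
    using cyc(3,4) xs \<open>?ws \<noteq> []\<close> by (cases vs) (auto simp: successively_append_iff hd_append)
  moreover have "(last ?ws, x) \<in> parcs G"
    using cyc(3,4) xs \<open>?ws \<noteq> []\<close> by (cases us) (auto simp: successively_append_iff successively_Cons last_append)
  moreover have "hd ?ws \<noteq> last ?ws"
    using len(1,2) by (cases ?ws) auto
  moreover have "hd ?ws \<in> set xs" "last ?ws \<in> set xs"
    using len(3) \<open>?ws \<noteq> []\<close> hd_in_set last_in_set by blast+
  ultimately show ?thesis
    using that[of "hd ?ws" "last ?ws"] arcs_symmetric by (auto simp: nbrs_def)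
qed

text \<open>Paths are listed backwards, from the end \<open>t\<close> to the start \<open>c\<close>.\<close>

lemma path_to_leaf:
  assumes "pair_graph G" "\<not> (\<exists>xs. vertex_cycle G xs)" "b \<in> nbrs G c"
  obtains t p rest ws where "t # p # rest = ws @ [b, c]" "distinct (t # p # rest)"
    "successively (\<lambda>u v. v \<in> nbrs G u) (t # p # rest)" "nbrs G t = {p}"
proof -
  interpret pair_graph G by fact
  let ?P = "\<lambda>xs. distinct xs \<and> successively (\<lambda>u v. (u, v) \<in> parcs G) xs \<and> set xs \<subseteq> pverts G \<and> (\<exists>ws. xs = ws @ [b, c])"
  have "(b, c) \<in> parcs G"
    using assms(3) arcs_symmetric by (simp add: nbrs_def)
  then have start: "?P [b, c]"
    using no_loops' by (auto dest: in_arcsD1 in_arcsD2)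
  have "length xs < Suc (card (pverts G))" if "distinct xs" "set xs \<subseteq> pverts G" for xs
    using card_mono[OF pair_finite_verts that(2)] distinct_card[OF that(1)] by simp
  then have bound: "\<forall>xs. ?P xs \<longrightarrow> length xs < Suc (card (pverts G))"
    by blast
  \<comment> \<open>A longest path among those whose last step is from \<open>b\<close> to
    \<open>c\<close>. Its front end \<open>t\<close> is the leaf: another neighbour of
    \<open>t\<close> would prolong the path or close a cycle.\<close>
  obtain xs where xs: "?P xs" and max: "\<And>ys. ?P ys \<Longrightarrow> length ys \<le> length xs"
    using ex_has_greatest_nat[of ?P, OF start bound] by blast
  then obtain ws where ws: "xs = ws @ [b, c]"
    by blast
  then obtain t p rest where tp: "xs = t # p # rest"
    by (cases ws; cases "tl ws") auto
  have "a = p" if "(t, a) \<in> parcs G" for a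
  proof (rule ccontr)
    assume "a \<noteq> p"
    have "a \<in> set xs"
    proof (rule ccontr)
      assume "a \<notin> set xs"
      have "(a, t) \<in> parcs G" "a \<in> pverts G"
        using that arcs_symmetric in_arcsD2 by blast+
      have "distinct (a # xs)" "set (a # xs) \<subseteq> pverts G"
        using xs \<open>a \<notin> set xs\<close> \<open>a \<in> pverts G\<close> by simp_all
      moreover have "successively (\<lambda>u v. (u, v) \<in> parcs G) (a # xs)"
        using xs \<open>(a, t) \<in> parcs G\<close> unfolding successively_Cons by (simp add: tp)
      moreover have "a # xs = (a # ws) @ [b, c]"
        using ws by simp
      ultimately have "?P (a # xs)"
        by blast
      from max[OF this] show False by simp
    qed
    moreover have "a \<noteq> t"
      using that no_loops' by blast
    ultimately have "a \<in> set rest"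
      using \<open>a \<noteq> p\<close> tp by simp
    then obtain us vs where "rest = us @ a # vs"
      by (meson split_list)
    then have "vertex_cycle G (t # p # us @ [a])"
      using xs that tp arcs_symmetric by (auto simp: vertex_cycle_def successively_Cons successively_append_iff hd_append)
    with assms(2) show False by blast
  qed
  moreover have "(t, p) \<in> parcs G"
    using xs tp by simp
  ultimately have "nbrs G t = {p}"
    unfolding nbrs_def by blast
  show ?thesis
  proof (rule that)
    show "t # p # rest = ws @ [b, c]"
      using tp ws by simp
    show "distinct (t # p # rest)" "successively (\<lambda>u v. v \<in> nbrs G u) (t # p # rest)"
      using xs unfolding tp nbrs_def mem_Collect_eq by blast+
  qed fact
qed

lemma card_le_2_eq_insert:
  assumes "finite A" "card A \<le> 2" "x \<in> A" "y \<in> A" "x \<noteq> y"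
  shows "A = {x, y}"
  using assms by (intro card_seteq[symmetric]) auto

text \<open>On the path l, b, e, f suppose \<open>f\<close> had another neighbour \<open>g\<close>.
  In a maximal stable set containing \<open>b\<close> and \<open>g\<close>, the vertex
  \<open>b\<close> could be exchanged for both \<open>l\<close> and \<open>e\<close>, since
  \<open>g\<close> keeps \<open>f\<close> out of the set.\<close>

lemma well_covered_pendant_path:
  assumes "pair_graph G" "well_covered G"
    and l: "nbrs G l = {b}" and b: "nbrs G b = {l, e}" and e: "nbrs G e = {b, f}"
    and "l \<noteq> e" "b \<noteq> f"
  shows "nbrs G f = {e}"
proof -
  note sym = nbrs_sym[OF assms(1)]
  have "e \<in> nbrs G f"
    using e sym[of e f] by simp
  moreover have "g = e" if g: "g \<in> nbrs G f" for g
  proof (rule ccontr)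
    assume "g \<noteq> e"
    have "f \<in> nbrs G g"
      using g sym[of g f] by simp
    then have "g \<noteq> l"
      using l \<open>b \<noteq> f\<close> by auto
    have "b \<notin> nbrs G g"
      using sym[of b g] b \<open>g \<noteq> e\<close> \<open>g \<noteq> l\<close> by auto
    have verts: "b \<in> pverts G" "l \<in> pverts G" "e \<in> pverts G" "g \<in> pverts G"
      using nbrs_in_verts[OF assms(1), of b l] nbrs_in_verts[OF assms(1), of e b]
        nbrs_in_verts[OF assms(1) g] l b by auto
    have "b \<noteq> l" "b \<noteq> e"
      using not_in_nbrs_self[OF assms(1), of b] b by auto
    have "stable_set G {b, g}"
      using verts \<open>b \<notin> nbrs G g\<close> sym[of b g] not_in_nbrs_self[OF assms(1)] by (auto simp: stable_set_nbrs_iff)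
    moreover have "stable_set G {l, e}"
      using verts l e \<open>b \<noteq> l\<close> \<open>b \<noteq> e\<close> sym[of e l] not_in_nbrs_self[OF assms(1), of e]
      by (auto simp: stable_set_nbrs_iff)
    ultimately have "card {l, e} \<le> card {b}"
    proof (intro well_covered_exchange_nbrs[OF assms(1,2), of "{b, g}"])
      show "v \<in> {b} \<or> nbrs G v \<inter> {b, g} \<noteq> {}" if "x \<in> {l, e}" "v \<in> nbrs G x" for x v
        using that l e g by auto
    qed (use l e in auto)
    with \<open>l \<noteq> e\<close> show False by simp
  qed
  ultimately show ?thesis by blast
qed

text \<open>Two leaves at \<open>c\<close> could be exchanged for \<open>c\<close>, gaining a
  vertex.\<close>

lemma well_covered_leaf_nbrs_unique:
  assumes "pair_graph G" "well_covered G" "nbrs G x = {c}" "nbrs G y = {c}"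
  shows "x = y"
proof (rule ccontr)
  assume "x \<noteq> y"
  have "c \<noteq> x" "c \<noteq> y"
    using not_in_nbrs_self[OF assms(1)] assms(3,4) by blast+
  have "x \<in> pverts G" "y \<in> pverts G" "c \<in> pverts G"
    using nbrs_in_verts[OF assms(1), of c x] nbrs_in_verts[OF assms(1), of c y] assms(3,4) by auto
  then have "stable_set G {c}" "stable_set G {x, y}"
    using assms(3,4) \<open>c \<noteq> x\<close> \<open>c \<noteq> y\<close> not_in_nbrs_self[OF assms(1)] by (auto simp: stable_set_nbrs_iff)
  then have "card {x, y} \<le> card {c}"
    using assms(3,4) by (intro well_covered_exchange_nbrs[OF assms(1,2), of "{c}"]) auto
  with \<open>x \<noteq> y\<close> show False by simp
qed

section \<open>Centres of well-covered spiders\<close>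

text \<open>Every leg at \<open>c\<close> has length one or two, and there is at least one leg. No
  lower bound of three on the degree is imposed, so short paths are covered as well.\<close>

definition spider_center :: "'a pair_pre_digraph \<Rightarrow> 'a \<Rightarrow> bool" where
  "spider_center G c \<longleftrightarrow> nbrs G c \<noteq> {} \<and>
    (\<forall>b\<in>nbrs G c. nbrs G b = {c} \<or> (\<exists>e. e \<noteq> c \<and> nbrs G b = {c, e} \<and> nbrs G e = {b}))"

text \<open>Follow the leg through \<open>b\<close> to its tip. If it had length three or more, the
  lemma on pendant paths would make the fourth vertex from the tip a leaf, although that vertex is
  \<open>c\<close> or lies strictly inside the leg.\<close>

lemma spider_center_if_branching:
  assumes "pair_graph G" "\<not> (\<exists>xs. vertex_cycle G xs)" "well_covered G"
    and deg_c: "card (nbrs G c) \<ge> 3" and deg: "\<And>v. v \<noteq> c \<Longrightarrow> card (nbrs G v) \<le> 2"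
  shows "spider_center G c"
  unfolding spider_center_def
proof (intro conjI ballI)
  note sym = nbrs_sym[OF assms(1)]
  note eqI = card_le_2_eq_insert[OF finite_nbrs[OF assms(1)] deg]
  show "nbrs G c \<noteq> {}"
    using deg_c by auto
  fix b assume b: "b \<in> nbrs G c"
  obtain t p rest ws where path: "t # p # rest = ws @ [b, c]" "distinct (t # p # rest)"
    "successively (\<lambda>u v. v \<in> nbrs G u) (t # p # rest)" and t: "nbrs G t = {p}"
    using assms(1,2) b by (rule path_to_leaf)
  \<comment> \<open>The three cases are legs of length one, length two, and at least three.\<close>
  consider "ws = []" | "ws = [t]" | ws' where "ws = t # p # ws'"
    using path(1) by (cases ws; cases "tl ws") auto
  then show "nbrs G b = {c} \<or> (\<exists>e. e \<noteq> c \<and> nbrs G b = {c, e} \<and> nbrs G e = {b})"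
  proof cases
    case 1
    then show ?thesis using path(1) t by simp
  next
    case 2
    then have [simp]: "p = b" "rest = [c]"
      using path(1) by auto
    have "nbrs G b = {c, t}"
      using path(2,3) sym[of t b] by (intro eqI) auto
    then show ?thesis
      using path(2) t by auto
  next
    case 3
    then have rest: "rest = ws' @ [b, c]"
      using path(1) by simp
    then obtain q f rest' where q: "rest = q # f # rest'"
      by (cases ws'; cases "tl ws'") auto
    have "c \<in> set (f # rest')"
      using rest q by (cases ws'; cases "tl ws'") auto
    then have "p \<noteq> c" "q \<noteq> c"
      using path(2) q by auto
    have p_nbrs: "nbrs G p = {t, q}"
      using path(2,3) q sym[of t p] \<open>p \<noteq> c\<close> by (intro eqI) auto
    have q_nbrs: "nbrs G q = {p, f}"
      using path(2,3) q sym[of p q] \<open>q \<noteq> c\<close> by (intro eqI) auto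
    have f: "nbrs G f = {q}"
      using path(2) q by (intro well_covered_pendant_path[OF assms(1,3) t p_nbrs q_nbrs]) auto
    \<comment> \<open>\<open>c\<close> has at least three neighbours but \<open>f\<close> only one.
      Hence the path continues beyond \<open>f\<close> to a second neighbour \<open>g\<close>, a
      contradiction.\<close>
    have "f \<noteq> c"
      using f deg_c by auto
    then obtain g rest'' where "rest' = g # rest''"
      using \<open>c \<in> set (f # rest')\<close> by (cases rest') auto
    then have "g \<in> nbrs G f" "g \<noteq> q"
      using path(2,3) q by auto
    with f show ?thesis by simp
  qed
qed

text \<open>Take for \<open>c\<close> the neighbour of a leaf \<open>l\<close>. If its other
  neighbour \<open>b\<close> continues to \<open>f\<close>, then l, c, b, f is a pendant path and
  \<open>f\<close> is a leaf.\<close>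

lemma spider_center_if_path:
  assumes "pair_graph G" "\<not> (\<exists>xs. vertex_cycle G xs)" "well_covered G" "b \<in> nbrs G a"
    and deg: "\<And>v. card (nbrs G v) \<le> 2"
  shows "\<exists>c. spider_center G c"
proof -
  note sym = nbrs_sym[OF assms(1)]
  note eqI = card_le_2_eq_insert[OF finite_nbrs[OF assms(1)] deg]
  obtain l c where l: "nbrs G l = {c}"
    using path_to_leaf[OF assms(1,2,4)] by metis
  have lc: "l \<in> nbrs G c"
    using l sym[of l c] by simp
  have "nbrs G b = {c} \<or> (\<exists>e. e \<noteq> c \<and> nbrs G b = {c, e} \<and> nbrs G e = {b})" if b: "b \<in> nbrs G c" for b
  proof (cases "b = l \<or> nbrs G b = {c}")
    case True
    then show ?thesis using l by auto
  next
    case False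
    have c: "nbrs G c = {l, b}"
      using lc b False by (intro eqI) auto
    have "c \<in> nbrs G b"
      using b sym[of b c] by simp
    with False obtain f where f: "f \<in> nbrs G b" "f \<noteq> c"
      by blast
    then have "nbrs G b = {c, f}"
      using \<open>c \<in> nbrs G b\<close> by (intro eqI) auto
    moreover from this have "nbrs G f = {b}"
      using l c False f by (intro well_covered_pendant_path[OF assms(1,3) l c]) auto
    ultimately show ?thesis
      using f by blast
  qed
  with lc show ?thesis
    unfolding spider_center_def by blast
qed

text \<open>At most one vertex has degree three or more: such a vertex is the centre, and without
  one the tree is a path. The edge between \<open>a\<close> and \<open>b\<close> excludes the single
  vertex.\<close>

lemma well_covered_spider_center:
  assumes "spider T" "well_covered T" "b \<in> nbrs T a"
  shows "\<exists>c. spider_center T c"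
proof -
  have T: "pair_graph T" "\<not> (\<exists>xs. vertex_cycle T xs)"
    and card: "card {v \<in> pverts T. card (nbrs T v) \<ge> 3} \<le> 1"
    using assms(1) by (auto simp: spider_def graph_tree_iff out_degree_eq_card_nbrs)
  interpret pair_graph T by fact
  let ?D = "{v \<in> pverts T. card (nbrs T v) \<ge> 3}"
  have D: "v \<in> ?D" if "card (nbrs T v) \<ge> 3" for v
  proof -
    from that obtain u where "u \<in> nbrs T v"
      by fastforce
    with that show ?thesis
      using nbrs_in_verts[OF T(1)] by blast
  qed
  show ?thesis
  proof (cases "\<exists>c. card (nbrs T c) \<ge> 3")
    case True
    then obtain c where c: "card (nbrs T c) \<ge> 3" ..
    have "card (nbrs T v) \<le> 2" if "v \<noteq> c" for v
    proof (rule ccontr)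
      assume "\<not> card (nbrs T v) \<le> 2"
      then have "{c, v} \<subseteq> ?D"
        using D c by simp
      then have "card {c, v} \<le> card ?D"
        using pair_finite_verts by (intro card_mono) auto
      with that card show False by simp
    qed
    then show ?thesis
      using spider_center_if_branching[OF T assms(2) c] by blast
  next
    case False
    then show ?thesis
      using spider_center_if_path[OF T assms(2,3)] by (simp add: not_less_eq_eq numeral_3_eq_3 numeral_2_eq_2)
  qed
qed

text \<open>If all legs had length two, the neighbours of \<open>c\<close> could be exchanged for
  their outer ends together with \<open>c\<close>, which is one vertex more.\<close>

lemma well_covered_spider_center_leaf:
  assumes "pair_graph G" "well_covered G" "spider_center G c"
  shows "\<exists>l. nbrs G l = {c}"
proof (rule ccontr)
  assume no_leaf: "\<nexists>l. nbrs G l = {c}"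
  note sym = nbrs_sym[OF assms(1)] and irrefl = not_in_nbrs_self[OF assms(1)]
  let ?B = "nbrs G c"
  have "\<forall>b\<in>?B. \<exists>e. e \<noteq> c \<and> nbrs G b = {c, e} \<and> nbrs G e = {b}"
    using assms(3) no_leaf unfolding spider_center_def by blast
  then obtain E where E: "\<And>b. b \<in> ?B \<Longrightarrow> E b \<noteq> c" "\<And>b. b \<in> ?B \<Longrightarrow> nbrs G b = {c, E b}"
    "\<And>b. b \<in> ?B \<Longrightarrow> nbrs G (E b) = {b}"
    by metis
  obtain b0 where b0: "b0 \<in> ?B"
    using assms(3) by (auto simp: spider_center_def)
  have inj: "inj_on E ?B"
    using E(3) by (metis inj_onI singleton_inject)
  have E_notin: "E b \<notin> ?B" if "b \<in> ?B" for b
    using E(3)[OF that] sym[of "E b" c] irrefl[of c] that by auto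
  have "stable_set G ?B"
    unfolding stable_set_nbrs_iff
  proof (intro conjI ballI subsetI)
    show "u \<in> pverts G" if "u \<in> ?B" for u
      using assms(1) that by (rule nbrs_in_verts)
    show "nbrs G u \<inter> ?B = {}" if "u \<in> ?B" for u
      using E(2)[OF that] E_notin[OF that] irrefl[of c] by simp
  qed
  moreover have "stable_set G (insert c (E ` ?B))"
    unfolding stable_set_nbrs_iff
  proof (intro conjI ballI)
    have "E b \<in> pverts G" if "b \<in> ?B" for b
      using nbrs_in_verts(2)[OF assms(1), of b "E b"] E(3)[OF that] by simp
    then show "insert c (E ` ?B) \<subseteq> pverts G"
      using nbrs_in_verts(2)[OF assms(1) b0] by blast
    have disj: "?B \<inter> insert c (E ` ?B) = {}"
      using irrefl[of c] E_notin by blast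
    show "nbrs G u \<inter> insert c (E ` ?B) = {}" if "u \<in> insert c (E ` ?B)" for u
    proof -
      have "nbrs G u \<subseteq> ?B"
        using that E(3) by auto
      with disj show ?thesis by blast
    qed
  qed
  ultimately have "card (insert c (E ` ?B)) \<le> card ?B"
  proof (intro well_covered_exchange_nbrs[OF assms(1,2), of ?B])
    show "x \<in> ?B \<or> nbrs G x \<inter> ?B \<noteq> {}" if "x \<in> insert c (E ` ?B)" for x
      using that E(3) b0 by auto
    show "v \<in> ?B \<or> nbrs G v \<inter> ?B \<noteq> {}" if "x \<in> insert c (E ` ?B)" "v \<in> nbrs G x" for x v
      using that E(3) by auto
  qed auto
  moreover have "c \<notin> E ` ?B"
    using E(1) by blast
  ultimately show False
    using finite_nbrs[OF assms(1), of c] inj by (simp add: card_image)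
qed

text \<open>Exactly one leg \<open>l\<close> has length one. It serves as the pendant of
  \<open>c\<close>, and the outer end \<open>E b\<close> of each other leg serves as the pendant of
  \<open>b\<close>; what remains is a star with centre \<open>c\<close>.\<close>

lemma graph_iso_pendant_star_if_center:
  assumes "pair_graph T" "graph_connected T" "well_covered T" and center: "spider_center T c"
  shows "\<exists>m. graph_iso (pendant_graph (star m)) T"
proof -
  interpret pair_graph T by fact
  note sym = nbrs_sym[OF assms(1)] and irrefl = not_in_nbrs_self[OF assms(1)]
  obtain l where l: "nbrs T l = {c}"
    using well_covered_spider_center_leaf[OF assms(1,3,4)] ..
  define B where "B = nbrs T c - {l}"
  have lc: "l \<in> nbrs T c"
    using l sym[of l c] by simp
  then have c: "nbrs T c = insert l B"
    by (auto simp: B_def)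
  have "nbrs T b \<noteq> {c}" if "b \<in> B" for b
    using well_covered_leaf_nbrs_unique[OF assms(1,3) l, of b] that by (auto simp: B_def)
  then have "\<forall>b\<in>B. \<exists>e. e \<noteq> c \<and> nbrs T b = {c, e} \<and> nbrs T e = {b}"
    using center unfolding spider_center_def B_def by blast
  then obtain E where E: "\<And>b. b \<in> B \<Longrightarrow> E b \<noteq> c" "\<And>b. b \<in> B \<Longrightarrow> nbrs T b = {c, E b}"
    "\<And>b. b \<in> B \<Longrightarrow> nbrs T (E b) = {b}"
    by metis
  have "c \<noteq> l" "c \<notin> B" "l \<notin> B"
    using irrefl[of c] lc by (auto simp: B_def)
  have E_notin: "E b \<notin> nbrs T c" if "b \<in> B" for b
    using E(3)[OF that] sym[of "E b" c] \<open>c \<notin> B\<close> that by auto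
  have E_inj: "E b = E b' \<longleftrightarrow> b = b'" if "b \<in> B" "b' \<in> B" for b b'
    using E(3) that by (metis singleton_inject)
  \<comment> \<open>\<open>H\<close> is this star drawn on vertices of \<open>T\<close>, and
    \<open>f\<close> below places its pendants.\<close>
  define W where "W = insert c B"
  define H where "H = \<lparr>pverts = W, parcs = {c} \<times> B \<union> B \<times> {c}\<rparr>"
  have W_sub: "W \<subseteq> pverts T"
    using nbrs_in_verts[OF assms(1), of _ c] lc by (auto simp: W_def B_def)
  have "finite W"
    using W_sub pair_finite_verts by (rule finite_subset)
  then have "pair_graph H"
    using \<open>c \<notin> B\<close> by unfold_locales (auto simp: H_def W_def symmetric_def intro!: symI)
  define f where "f = case_sum id (\<lambda>v. if v = c then l else E v)"
  have f_simps: "f (Inl v) = v" "f (Inr c) = l" "b \<in> B \<Longrightarrow> f (Inr b) = E b" for v b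
    using \<open>c \<notin> B\<close> by (auto simp: f_def)
  have E_ne: "E b \<noteq> l" "E b \<notin> B" "l \<noteq> E b" "c \<noteq> E b" if "b \<in> B" for b
    using E_notin[OF that] E(1)[OF that] c by auto
  have "bij_betw f (pverts (pendant_graph H)) (pverts T)"
    unfolding bij_betw_def
  proof
    show "inj_on f (pverts (pendant_graph H))"
      using \<open>c \<noteq> l\<close> \<open>c \<notin> B\<close> \<open>l \<notin> B\<close>
      by (auto simp: inj_on_def f_simps H_def W_def E(1) E_ne E_inj)
    have "(\<lambda>v. f (Inr v)) ` W = insert l (E ` B)"
      by (simp add: W_def f_simps cong: image_cong_simp)
    then have image: "f ` pverts (pendant_graph H) = W \<union> insert l (E ` B)"
      by (simp add: H_def image_Un image_image f_simps)
    have "W \<union> insert l (E ` B) \<subseteq> pverts T"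
    proof -
      have "E b \<in> pverts T" if "b \<in> B" for b
        using nbrs_in_verts(2)[OF assms(1), of b "E b"] E(3)[OF that] by simp
      then show ?thesis
        using W_sub nbrs_in_verts(1)[OF assms(1) lc] by blast
    qed
    \<comment> \<open>The image is closed under adjacency, so connectivity makes it all of
      \<open>T\<close>.\<close>
    moreover have "pverts T \<subseteq> W \<union> insert l (E ` B)"
    proof (rule graph_connected_closed_set[OF assms(1,2), of c])
      show "v \<in> W \<union> insert l (E ` B)" if "u \<in> W \<union> insert l (E ` B)" "(u, v) \<in> parcs T" for u v
      proof -
        have "v \<in> nbrs T u"
          using that(2) by (simp add: nbrs_def)
        with that(1) show ?thesis
          by (auto simp: W_def l c E(2,3))
      qed
    qed (use W_sub in \<open>auto simp: W_def\<close>)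
    ultimately show "f ` pverts (pendant_graph H) = pverts T"
      using image by blast
  qed
  moreover have "(x, y) \<in> parcs (pendant_graph H) \<longleftrightarrow> (f x, f y) \<in> parcs T"
    if "x \<in> pverts (pendant_graph H)" "y \<in> pverts (pendant_graph H)" for x y
  proof -
    have adj: "(u, v) \<in> parcs T \<longleftrightarrow> v \<in> nbrs T u" for u v
      by (simp add: nbrs_def)
    show ?thesis
      using that \<open>c \<noteq> l\<close> \<open>c \<notin> B\<close> \<open>l \<notin> B\<close> unfolding adj
      by (auto simp: f_simps H_def W_def c l E E_ne E_inj)
  qed
  ultimately have "graph_iso (pendant_graph H) T"
    unfolding graph_iso_iff_bij_betw[OF pair_graph_pendant_graph[OF \<open>pair_graph H\<close>] assms(1)] by blast
  moreover have "graph_iso H (star (card B))"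
    using \<open>pair_graph H\<close> \<open>c \<notin> B\<close> by (intro graph_iso_star[of _ c]) (auto simp: H_def W_def)
  then have "graph_iso (star (card B)) H"
    by (rule graph_iso_sym[OF \<open>pair_graph H\<close> pair_graph_star])
  ultimately have "graph_iso (pendant_graph (star (card B))) T"
    using \<open>pair_graph H\<close> assms(1)
    by (meson graph_iso_trans graph_iso_pendant_graph pair_graph_pendant_graph pair_graph_star)
  then show ?thesis ..
qed

text \<open>A spider with an edge has a centre in the above sense; a connected graph without edges
  is a single vertex.\<close>

lemma well_covered_spider_cases:
  assumes "spider T" "well_covered T"
  shows "card (pverts T) = 1 \<or> (\<exists>m. graph_iso (pendant_graph (star m)) T)"
proof (cases "\<exists>a b. b \<in> nbrs T a")
  case True
  then show ?thesis
    using assms well_covered_spider_center graph_iso_pendant_star_if_center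
    by (meson graph_tree_iff spider_def)
next
  case False
  have T: "pair_graph T" "graph_connected T"
    using assms(1) by (auto simp: spider_def graph_tree_iff)
  then obtain v where v: "v \<in> pverts T"
    by (auto simp: graph_connected_def connected_conv)
  have "pverts T \<subseteq> {v}"
    using False v by (intro graph_connected_closed_set[OF T, of v]) (auto simp: nbrs_def)
  with v have "pverts T = {v}" by blast
  then show ?thesis by simp
qed

section \<open>Pendant stars as spiders and recovery from the polynomial\<close>

text \<open>A cycle contains no pendant, as each of its vertices needs two neighbours on it. Without
  its pendant a vertex \<open>Inl v\<close> other than \<open>Inl 0\<close> has only
  \<open>Inl 0\<close> left, so no cycle exists.\<close>

lemma spider_pendant_star: "spider (pendant_graph (star n))"
proof -
  let ?S = "pendant_graph (star n)"
  have S: "pair_graph ?S"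
    by (intro pair_graph_pendant_graph pair_graph_star)
  have nbrs_Inr: "nbrs ?S (Inr v) \<subseteq> {Inl v}" for v
  proof
    fix x assume "x \<in> nbrs ?S (Inr v)"
    then show "x \<in> {Inl v}" by (cases x) (auto simp: nbrs_def)
  qed
  have nbrs_Inl: "nbrs ?S (Inl v) \<subseteq> {Inl 0, Inr v}" if "v \<noteq> 0" for v
  proof
    fix x assume "x \<in> nbrs ?S (Inl v)"
    with that show "x \<in> {Inl 0, Inr v}" by (cases x) (auto simp: nbrs_def star_def)
  qed
  have "graph_connected ?S"
  proof (rule graph_connectedI[OF S])
    show "Inl 0 \<in> pverts ?S"
      by (simp add: star_def)
    fix A assume A: "Inl 0 \<in> A" "\<And>u v. u \<in> A \<Longrightarrow> (u, v) \<in> parcs ?S \<Longrightarrow> v \<in> A"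
    have "Inl v \<in> A" if "v \<le> n" for v
    proof (cases "v = 0")
      case False
      with that have "(Inl 0, Inl v) \<in> parcs ?S"
        by (auto simp: star_def)
      with A show ?thesis by blast
    qed (use A in simp)
    moreover from this have "Inr v \<in> A" if "v \<le> n" for v
      using that A(2)[of "Inl v" "Inr v"] by (simp add: star_def)
    ultimately show "pverts ?S \<subseteq> A"
      by (auto simp: star_def)
  qed
  moreover have "\<not> vertex_cycle ?S xs" for xs
  proof
    assume xs: "vertex_cycle ?S xs"
    have "x = Inl 0" if x: "x \<in> set xs" for x
    proof (rule ccontr)
      assume "x \<noteq> Inl 0"
      have not_Inr: "Inr v \<notin> set xs" for v
      proof
        assume "Inr v \<in> set xs"
        with S xs obtain y z where "y \<noteq> z" "y \<in> nbrs ?S (Inr v)" "z \<in> nbrs ?S (Inr v)"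
          by (rule vertex_cycle_two_nbrs)
        with nbrs_Inr[of v] show False by blast
      qed
      with x obtain v where v: "x = Inl v"
        by (metis sumE)
      obtain y z where "y \<in> set xs" "z \<in> set xs" "y \<noteq> z" "y \<in> nbrs ?S x" "z \<in> nbrs ?S x"
        using S xs x by (rule vertex_cycle_two_nbrs)
      moreover have "nbrs ?S x \<subseteq> {Inl 0, Inr v}"
        using nbrs_Inl[of v] v \<open>x \<noteq> Inl 0\<close> by simp
      ultimately show False
        using not_Inr[of v] by blast
    qed
    then have "card (set xs) \<le> card {Inl 0 :: nat + nat}"
      by (intro card_mono) auto
    moreover have "card (set xs) \<ge> 3"
      using xs by (simp add: vertex_cycle_def distinct_card)
    ultimately show False by simp
  qed
  moreover have "card {v \<in> pverts ?S. card (nbrs ?S v) \<ge> 3} \<le> 1"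
  proof -
    have "v = Inl 0" if "card (nbrs ?S v) \<ge> 3" for v
    proof (rule ccontr)
      assume "v \<noteq> Inl 0"
      then obtain x y where "nbrs ?S v \<subseteq> {x, y}"
        using nbrs_Inr nbrs_Inl by (cases v) blast+
      then have "card (nbrs ?S v) \<le> card {x, y}"
        by (intro card_mono) auto
      also have "\<dots> \<le> 2"
        by (simp add: card_insert_if)
      finally show False using that by simp
    qed
    then have "card {v \<in> pverts ?S. card (nbrs ?S v) \<ge> 3} \<le> card {Inl 0 :: nat + nat}"
      by (intro card_mono) auto
    then show ?thesis by simp
  qed
  ultimately show ?thesis
    using S by (simp add: spider_def graph_tree_iff out_degree_eq_card_nbrs)
qed

text \<open>The coefficient of x gives the order of \<open>T\<close>, which is even, so
  \<open>T\<close> is a pendant star. The multiplicity of -1 then makes \<open>G\<close> a star, and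
  its order fixes the number of leaves.\<close>

lemma graph_iso_pendant_graph_spider:
  assumes G: "pair_graph G" "graph_connected (pendant_graph G)"
    and T: "well_covered T" "spider T" and eq: "indep_poly (pendant_graph G) = indep_poly T"
  shows "graph_iso (pendant_graph G) T"
proof -
  interpret pair_graph G by fact
  have "pair_graph T"
    using T(2) by (simp add: spider_def graph_tree_iff)
  note star = pair_graph_star and pendant = pair_graph_pendant_graph
  have "card (pverts (pendant_graph G)) = card (pverts T)"
    using coeff_indep_poly_1[OF pendant[OF G(1)]] coeff_indep_poly_1[OF \<open>pair_graph T\<close>] eq by simp
  then have card_T: "card (pverts T) = 2 * card (pverts G)"
    by (simp only: card_verts_pendant_graph[OF pair_finite_verts])
  then have "card (pverts T) \<noteq> 1"
    by presburger
  then obtain m where m: "graph_iso (pendant_graph (star m)) T"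
    using well_covered_spider_cases[OF T(2,1)] by blast
  have "card (pverts T) = 2 * Suc m"
    using graph_iso_card_verts[OF pendant[OF star] \<open>pair_graph T\<close> m] card_verts_pendant_graph[of "star m"]
    by (simp add: star_def)
  with card_T have card_G: "card (pverts G) = Suc m"
    by simp
  have "graph_iso G (star m)"
  \<comment> \<open>For m = 0 the multiplicity is 0 and the criterion says nothing; there
    \<open>G\<close> has a single vertex, and the empty stable set gives the isomorphism with
    \<open>star 0\<close>.\<close>
  proof (cases "m = 0")
    case True
    then show ?thesis
      using graph_iso_star_if_large_stable_set[OF G, of "{}"] card_G by simp
  next
    case False
    have "indep_poly (pendant_graph G) = indep_poly (pendant_graph (star m))"
      using eq indep_poly_cong_graph_iso[OF pendant[OF star] \<open>pair_graph T\<close> m] by simp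
    then obtain k where k: "graph_iso G (star k)"
      using False order_indep_poly_pendant_star[of m] order_eq_1_iff_star[OF G] by auto
    then have "k = m"
      using graph_iso_card_verts[OF G(1) star k] card_G by (simp add: star_def)
    with k show ?thesis by simp
  qed
  then show ?thesis
    using G(1) m \<open>pair_graph T\<close> by (meson graph_iso_trans graph_iso_pendant_graph pendant star)
qed

theorem theorem5:
  shows "(\<forall>n\<ge>2. well_covered (pendant_graph (star n)) \<and> spider (pendant_graph (star n)) \<and>
            indep_poly (pendant_graph (star n)) =
              [:1, 1:] * (1 + (\<Sum>k=1..n.
                monom (of_nat ((n choose k) * 2 ^ k + ((n - 1) choose (k - 1)))) k)))
    \<and> (\<forall>G :: 'a pair_pre_digraph.
          pair_graph G \<and> graph_connected (pendant_graph G) \<longrightarrow>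
            (order (-1) (indep_poly (pendant_graph G)) = 1 \<longleftrightarrow> (\<exists>n\<ge>1. graph_iso G (star n))))
    \<and> (\<forall>(G :: 'a pair_pre_digraph) (T :: 'b pair_pre_digraph).
          pair_graph G \<and> graph_connected (pendant_graph G) \<and>
          well_covered T \<and> spider T \<and> indep_poly (pendant_graph G) = indep_poly T \<longrightarrow>
            graph_iso (pendant_graph G) T)"
proof (intro conjI allI impI)
  fix n :: nat assume "2 \<le> n"
  then show "indep_poly (pendant_graph (star n)) = [:1, 1:] * (1 + (\<Sum>k=1..n.
      monom (of_nat ((n choose k) * 2 ^ k + ((n - 1) choose (k - 1)))) k))"
    by (intro indep_poly_pendant_star) simp
next
  fix G :: "'a pair_pre_digraph" assume "pair_graph G \<and> graph_connected (pendant_graph G)"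
  then show "order (-1) (indep_poly (pendant_graph G)) = 1 \<longleftrightarrow> (\<exists>n\<ge>1. graph_iso G (star n))"
    by (intro order_eq_1_iff_star) auto
next
  fix G :: "'a pair_pre_digraph" and T :: "'b pair_pre_digraph"
  assume "pair_graph G \<and> graph_connected (pendant_graph G) \<and> well_covered T \<and> spider T \<and>
    indep_poly (pendant_graph G) = indep_poly T"
  then show "graph_iso (pendant_graph G) T"
    by (intro graph_iso_pendant_graph_spider) auto
qed (rule well_covered_pendant_graph spider_pendant_star)+

end
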